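(* Let $R \subseteq I_1 \times \dots \times I_m$ be a multiway relation between sets $I_1,\dots,I_m$, and let $\mathcal{D}(R)$ be its Dowker relational product. Then for every $k \in \{1,\dots,m\}$ the geometric Dowkerian quotient map $$|\psi_k| : |\mathcal{D}(R)| \twoheadrightarrow |\mathcal{D}(R)/I_k|$$ is a homotopy equivalence.
   Context: For a set $I$, $\Delta I$ denotes the set of all non-empty finite subsets of $I$, partially ordered by inclusion. A prod-complex on sets $I_1,\dots,I_m$ is a downwardly closed subset $P$ of the product poset $\Delta I_1 \times \dots \times \Delta I_m$; its elements $\sigma = (\sigma_1,\dots,\sigma_m)$ are called prod-simplices. Geometric realization: $\mathbb{R}_I$ is the real vector space of families $(x_i)_{i\in I}$ with finitely many non-zero entries, with the direct-limit topology (a set is closed iff its intersection with $\mathbb{R}_F$ is closed for each finite $F \subseteq I$), and $\varepsilon(i)\in\mathbb{R}_I$ is the standard basis vector of $i \in I$. For $\sigma\in\Delta I$, $|\sigma| = \mathrm{conv}\{\varepsilon(i) \mid i\in\sigma\}$. For a prod-simplex, $|\sigma| = |\sigma_1|\times\dots\times|\sigma_m|$, and $|P| = \bigcup_{\sigma\in P}|\sigma|$, which is a subcomplex of the CW-complex $|\Delta I_1|\times\dots\times|\Delta I_m|$. Products are taken in compactly generated Hausdorff spaces; equivalently, a subset of $|P|$ is closed iff its intersection with each closed cell $|\sigma|$, $\sigma\in P$, is closed. Dowkerian quotient: for a prod-complex $P$ on $I_1,\dots,I_m$, $P/I_k$ is the prod-complex on $I_1,\dots,\widehat{I_k},\dots,I_m$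 (hat denotes omission) given by $P/I_k = \{(\sigma_1,\dots,\widehat{\sigma_k},\dots,\sigma_m) \mid (\sigma_1,\dots,\sigma_m)\in P\}$. The map $\psi_k : P \to P/I_k$ deletes the $k$-th factor of each prod-simplex; its geometric realization $|\psi_k| : |P|\to|P/I_k|$ is the restriction of the projection $|\Delta I_1|\times\dots\times|\Delta I_m| \to |\Delta I_1|\times\dots\times\widehat{|\Delta I_k|}\times\dots\times|\Delta I_m|$ eliminating the $k$-th factor. Dowker relational product: $\mathcal{D}(R) = \{(\sigma_1,\dots,\sigma_m)\in\Delta I_1\times\dots\times\Delta I_m \mid \sigma_1\times\dots\times\sigma_m\subseteq R\}$. *)

theory Defs
  imports "HOL-Analysis.Analysis" "HOL-Analysis.Finite_Function_Topology"
begin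

section \<open>Topologies determined by a family of subspaces\<close>

text \<open>The topology on \<open>\<Union>\<C>\<close> whose closed sets are those meeting every
  \<open>A \<in> \<C>\<close> in a closed subset of the subspace \<open>A\<close> of \<open>X\<close>; see
  \<open>closedin_coherent_topology\<close> below. It is meant for families with
  \<open>\<Union>\<C> \<subseteq> topspace X\<close>.\<close>

definition coherent_topology :: "'a topology \<Rightarrow> 'a set set \<Rightarrow> 'a topology" where
  "coherent_topology X \<C> =
     topology (\<lambda>U. U \<subseteq> \<Union>\<C> \<and> (\<forall>A\<in>\<C>. openin (subtopology X A) (U \<inter> A)))"

lemma openin_coherent_topology:
  "openin (coherent_topology X \<C>) U \<longleftrightarrow>
     U \<subseteq> \<Union>\<C> \<and> (\<forall>A\<in>\<C>. openin (subtopology X A) (U \<inter> A))"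
proof -
  have "istopology (\<lambda>U. U \<subseteq> \<Union>\<C> \<and> (\<forall>A\<in>\<C>. openin (subtopology X A) (U \<inter> A)))"
    unfolding istopology_def
  proof (intro conjI allI impI ballI)
    fix S T A
    assume S: "S \<subseteq> \<Union>\<C> \<and> (\<forall>A\<in>\<C>. openin (subtopology X A) (S \<inter> A))"
      and T: "T \<subseteq> \<Union>\<C> \<and> (\<forall>A\<in>\<C>. openin (subtopology X A) (T \<inter> A))"
    show "S \<inter> T \<subseteq> \<Union>\<C>" using S by blast
    assume "A \<in> \<C>"
    then have "openin (subtopology X A) (S \<inter> A)" "openin (subtopology X A) (T \<inter> A)"
      using S T by blast+
    then have "openin (subtopology X A) ((S \<inter> A) \<inter> (T \<inter> A))"
      by (rule openin_Int)
    moreover have "(S \<inter> A) \<inter> (T \<inter> A) = S \<inter> T \<inter> A" by blast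
    ultimately show "openin (subtopology X A) (S \<inter> T \<inter> A)" by simp
  next
    fix \<K> A
    assume K: "\<forall>K\<in>\<K>. K \<subseteq> \<Union>\<C> \<and> (\<forall>A\<in>\<C>. openin (subtopology X A) (K \<inter> A))"
    show "\<Union>\<K> \<subseteq> \<Union>\<C>" using K by blast
    assume "A \<in> \<C>"
    then have "openin (subtopology X A) (\<Union>K\<in>\<K>. K \<inter> A)"
      using K by (intro openin_Union) blast
    moreover have "(\<Union>K\<in>\<K>. K \<inter> A) = \<Union>\<K> \<inter> A" by blast
    ultimately show "openin (subtopology X A) (\<Union>\<K> \<inter> A)" by simp
  qed
  then show ?thesis
    by (simp add: coherent_topology_def)
qed

lemma topspace_coherent_topology:
  assumes "\<Union>\<C> \<subseteq> topspace X"
  shows "topspace (coherent_topology X \<C>) = \<Union>\<C>"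
proof
  have "openin (coherent_topology X \<C>) (topspace (coherent_topology X \<C>))"
    by (rule openin_topspace)
  then show "topspace (coherent_topology X \<C>) \<subseteq> \<Union>\<C>"
    unfolding openin_coherent_topology by (rule conjunct1)
  have "openin (subtopology X A) (\<Union>\<C> \<inter> A)" if "A \<in> \<C>" for A
  proof -
    have "\<Union>\<C> \<inter> A = topspace (subtopology X A)"
      unfolding topspace_subtopology using that assms by blast
    then show ?thesis using openin_topspace[of "subtopology X A"] by (rule ssubst)
  qed
  then have "openin (coherent_topology X \<C>) (\<Union>\<C>)"
    unfolding openin_coherent_topology by blast
  then show "\<Union>\<C> \<subseteq> topspace (coherent_topology X \<C>)"
    by (rule openin_subset)
qed

lemma closedin_coherent_topology:
  assumes "\<Union>\<C> \<subseteq> topspace X"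
  shows "closedin (coherent_topology X \<C>) S \<longleftrightarrow>
     S \<subseteq> \<Union>\<C> \<and> (\<forall>A\<in>\<C>. closedin (subtopology X A) (S \<inter> A))"
proof -
  have "closedin (subtopology X A) (S \<inter> A) \<longleftrightarrow> openin (subtopology X A) ((\<Union>\<C> - S) \<inter> A)"
    if "A \<in> \<C>" for A
  proof -
    have "A \<subseteq> \<Union>\<C>" "topspace (subtopology X A) = A"
      using that assms by auto
    moreover from this have "A - S \<inter> A = (\<Union>\<C> - S) \<inter> A" by blast
    ultimately show ?thesis by (simp add: closedin_def)
  qed
  then show ?thesis
    by (auto simp: closedin_def topspace_coherent_topology[OF assms] openin_coherent_topology)
qed


section \<open>The spaces \<open>\<real>\<^sub>I\<close> and geometric simplices\<close>

definition finsupp_on :: "'a set \<Rightarrow> ('a \<Rightarrow>\<^sub>0 real) set" where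
  "finsupp_on I = {x. Poly_Mapping.keys x \<subseteq> I}"

text \<open>The library topology on \<^typ>\<open>'a \<Rightarrow>\<^sub>0 real\<close> is that of the \<open>\<ell>\<^sup>1\<close> norm. It is used
  only through its restriction to \<^term>\<open>finsupp_on F\<close> for finite \<^term>\<open>F\<close>, where it is the
  usual topology of a finite-dimensional real vector space. Then \<open>\<real>\<^sub>I\<close> carries
  the direct limit topology, which is finer than the norm topology for infinite \<open>I\<close>.\<close>

definition real_space :: "'a set \<Rightarrow> ('a \<Rightarrow>\<^sub>0 real) topology" where
  "real_space I = coherent_topology euclidean (finsupp_on ` Fpow I)"

definition basis_vec :: "'a \<Rightarrow> ('a \<Rightarrow>\<^sub>0 real)" where
  "basis_vec i = Poly_Mapping.single i 1"

definition geom_simplex :: "'a set \<Rightarrow> ('a \<Rightarrow>\<^sub>0 real) set" where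
  "geom_simplex \<sigma> = convex hull (basis_vec ` \<sigma>)"

lemma topspace_real_space: "topspace (real_space I) = finsupp_on I"
proof -
  have "topspace (real_space I) = \<Union>(finsupp_on ` Fpow I)"
    unfolding real_space_def by (rule topspace_coherent_topology) simp
  also have "\<dots> = finsupp_on I"
  proof
    show "\<Union>(finsupp_on ` Fpow I) \<subseteq> finsupp_on I"
      by (auto simp: finsupp_on_def Fpow_def)
    show "finsupp_on I \<subseteq> \<Union>(finsupp_on ` Fpow I)"
    proof
      fix x assume "x \<in> finsupp_on I"
      then have "Poly_Mapping.keys x \<in> Fpow I" by (simp add: finsupp_on_def Fpow_def)
      moreover have "x \<in> finsupp_on (Poly_Mapping.keys x)" by (simp add: finsupp_on_def)
      ultimately show "x \<in> \<Union>(finsupp_on ` Fpow I)" by blast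
    qed
  qed
  finally show ?thesis .
qed

lemma closedin_real_space:
  "closedin (real_space I) S \<longleftrightarrow>
     S \<subseteq> finsupp_on I \<and>
     (\<forall>F. F \<subseteq> I \<and> finite F \<longrightarrow> closedin (top_of_set (finsupp_on F)) (S \<inter> finsupp_on F))"
proof -
  have "\<Union>(finsupp_on ` Fpow I) = finsupp_on I"
    using topspace_real_space[of I] unfolding real_space_def
    by (simp add: topspace_coherent_topology)
  then show ?thesis
    unfolding real_space_def
    by (subst closedin_coherent_topology) (auto simp: Fpow_def)
qed

lemma convex_finsupp_on: "convex (finsupp_on I)"
proof (rule convexI)
  fix x y :: "'a \<Rightarrow>\<^sub>0 real" and u v :: real
  assume "x \<in> finsupp_on I" "y \<in> finsupp_on I"
  then have "Poly_Mapping.lookup x i = 0" "Poly_Mapping.lookup y i = 0" if "i \<notin> I" for i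
    using that unfolding finsupp_on_def by (metis in_keys_iff mem_Collect_eq subsetD)+
  then have "Poly_Mapping.lookup (u *\<^sub>R x + v *\<^sub>R y) i = 0" if "i \<notin> I" for i
    using that by (simp add: lookup_add scaleR_poly_mapping_def)
  then show "u *\<^sub>R x + v *\<^sub>R y \<in> finsupp_on I"
    by (auto simp: finsupp_on_def in_keys_iff)
qed

lemma geom_simplex_subset: "\<sigma> \<subseteq> I \<Longrightarrow> geom_simplex \<sigma> \<subseteq> finsupp_on I"
  unfolding geom_simplex_def
  by (rule hull_minimal) (auto simp: basis_vec_def finsupp_on_def convex_finsupp_on[unfolded finsupp_on_def])


section \<open>Prod-complexes and their realizations\<close>

text \<open>Factors are indexed by an arbitrary set \<^term>\<open>J\<close> of natural numbers, so that omitting the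
  \<^term>\<open>k\<close>-th factor amounts to passing from \<^term>\<open>J\<close> to \<^term>\<open>J - {k}\<close> without renumbering.
  Tuples are extensional functions on \<^term>\<open>J\<close>. The sets \<open>I j\<close> live in one common type, into
  which any family of sets can be embedded.\<close>

definition Delta :: "'a set \<Rightarrow> 'a set set" where
  "Delta I = Fpow I - {{}}"

definition prod_complex :: "nat set \<Rightarrow> (nat \<Rightarrow> 'a set) \<Rightarrow> (nat \<Rightarrow> 'a set) set \<Rightarrow> bool" where
  "prod_complex J I P \<longleftrightarrow>
     P \<subseteq> (\<Pi>\<^sub>E j\<in>J. Delta (I j)) \<and>
     (\<forall>\<sigma>\<in>P. \<forall>\<tau>\<in>(\<Pi>\<^sub>E j\<in>J. Delta (I j)). (\<forall>j\<in>J. \<tau> j \<subseteq> \<sigma> j) \<longrightarrow> \<tau> \<in> P)"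

definition geom_cell :: "nat set \<Rightarrow> (nat \<Rightarrow> 'a set) \<Rightarrow> (nat \<Rightarrow> 'a \<Rightarrow>\<^sub>0 real) set" where
  "geom_cell J \<sigma> = (\<Pi>\<^sub>E j\<in>J. geom_simplex (\<sigma> j))"

definition realization ::
  "nat set \<Rightarrow> (nat \<Rightarrow> 'a set) \<Rightarrow> (nat \<Rightarrow> 'a set) set \<Rightarrow> (nat \<Rightarrow> 'a \<Rightarrow>\<^sub>0 real) topology" where
  "realization J I P =
     coherent_topology (product_topology (\<lambda>j. real_space (I j)) J) (geom_cell J ` P)"

lemma geom_cells_subset:
  assumes "prod_complex J I P"
  shows "\<Union>(geom_cell J ` P) \<subseteq> topspace (product_topology (\<lambda>j. real_space (I j)) J)"
proof -
  have "geom_cell J \<sigma> \<subseteq> (\<Pi>\<^sub>E j\<in>J. finsupp_on (I j))" if "\<sigma> \<in> P" for \<sigma>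
  proof -
    have "\<sigma> \<in> (\<Pi>\<^sub>E j\<in>J. Delta (I j))"
      using assms \<open>\<sigma> \<in> P\<close> unfolding prod_complex_def by blast
    then have "\<sigma> j \<subseteq> I j" if "j \<in> J" for j
      using PiE_mem[OF _ that, of \<sigma> "\<lambda>j. Delta (I j)"] by (simp add: Delta_def Fpow_def)
    then show ?thesis
      unfolding geom_cell_def by (intro PiE_mono geom_simplex_subset) auto
  qed
  then show ?thesis
    unfolding topspace_product_topology o_def topspace_real_space by blast
qed

lemma topspace_realization:
  "prod_complex J I P \<Longrightarrow> topspace (realization J I P) = (\<Union>\<sigma>\<in>P. geom_cell J \<sigma>)"
  unfolding realization_def by (intro topspace_coherent_topology geom_cells_subset)

lemma closedin_realization:
  assumes "prod_complex J I P"
  shows "closedin (realization J I P) S \<longleftrightarrow>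
     S \<subseteq> (\<Union>\<sigma>\<in>P. geom_cell J \<sigma>) \<and>
     (\<forall>\<sigma>\<in>P. closedin (subtopology (product_topology (\<lambda>j. real_space (I j)) J) (geom_cell J \<sigma>))
                      (S \<inter> geom_cell J \<sigma>))"
  unfolding realization_def closedin_coherent_topology[OF geom_cells_subset[OF assms]]
  by blast


section \<open>Dowker relational product and Dowkerian quotient\<close>

definition dowker_product ::
  "nat set \<Rightarrow> (nat \<Rightarrow> 'a set) \<Rightarrow> (nat \<Rightarrow> 'a) set \<Rightarrow> (nat \<Rightarrow> 'a set) set" where
  "dowker_product J I R = {\<sigma> \<in> (\<Pi>\<^sub>E j\<in>J. Delta (I j)). (\<Pi>\<^sub>E j\<in>J. \<sigma> j) \<subseteq> R}"

definition omit_factor :: "nat set \<Rightarrow> nat \<Rightarrow> (nat \<Rightarrow> 'b) \<Rightarrow> (nat \<Rightarrow> 'b)" where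
  "omit_factor J k x = restrict x (J - {k})"

definition dowkerian_quotient ::
  "nat set \<Rightarrow> nat \<Rightarrow> (nat \<Rightarrow> 'a set) set \<Rightarrow> (nat \<Rightarrow> 'a set) set" where
  "dowkerian_quotient J k P = omit_factor J k ` P"

text \<open>Only the values on the topspace of \<^term>\<open>realization J I P\<close> matter.\<close>

definition geom_quotient_map ::
  "nat set \<Rightarrow> nat \<Rightarrow> (nat \<Rightarrow> 'a \<Rightarrow>\<^sub>0 real) \<Rightarrow> (nat \<Rightarrow> 'a \<Rightarrow>\<^sub>0 real)" where
  "geom_quotient_map J k = omit_factor J k"

lemma prod_complex_dowker_product: "prod_complex J I (dowker_product J I R)"
  unfolding prod_complex_def
proof (intro conjI ballI impI)
  show "dowker_product J I R \<subseteq> (\<Pi>\<^sub>E j\<in>J. Delta (I j))"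
    unfolding dowker_product_def by blast
next
  fix \<sigma> \<tau>
  assume \<sigma>: "\<sigma> \<in> dowker_product J I R" and \<tau>: "\<tau> \<in> (\<Pi>\<^sub>E j\<in>J. Delta (I j))"
    and "\<forall>j\<in>J. \<tau> j \<subseteq> \<sigma> j"
  then have "(\<Pi>\<^sub>E j\<in>J. \<tau> j) \<subseteq> (\<Pi>\<^sub>E j\<in>J. \<sigma> j)"
    by (intro PiE_mono) blast
  also have "\<dots> \<subseteq> R"
    using \<sigma> unfolding dowker_product_def by blast
  finally show "\<tau> \<in> dowker_product J I R"
    using \<tau> unfolding dowker_product_def by blast
qed

lemma prod_complex_dowkerian_quotient:
  assumes P: "prod_complex J I P" and k: "k \<in> J"
  shows "prod_complex (J - {k}) I (dowkerian_quotient J k P)"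
  unfolding prod_complex_def
proof (intro conjI ballI impI)
  show "dowkerian_quotient J k P \<subseteq> (\<Pi>\<^sub>E j\<in>J - {k}. Delta (I j))"
    unfolding dowkerian_quotient_def
  proof (rule image_subsetI)
    fix \<rho> assume "\<rho> \<in> P"
    then have "\<rho> \<in> (\<Pi>\<^sub>E j\<in>J. Delta (I j))"
      using P unfolding prod_complex_def by blast
    then show "omit_factor J k \<rho> \<in> (\<Pi>\<^sub>E j\<in>J - {k}. Delta (I j))"
      by (simp add: omit_factor_def PiE_iff)
  qed
next
  fix \<sigma> \<tau>
  assume "\<sigma> \<in> dowkerian_quotient J k P"
    and \<tau>: "\<tau> \<in> (\<Pi>\<^sub>E j\<in>J - {k}. Delta (I j))"
    and le: "\<forall>j\<in>J - {k}. \<tau> j \<subseteq> \<sigma> j"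
  then obtain \<rho> where \<rho>: "\<rho> \<in> P" "\<sigma> = omit_factor J k \<rho>"
    by (auto simp: dowkerian_quotient_def)
  have \<rho>': "\<rho> \<in> (\<Pi>\<^sub>E j\<in>J. Delta (I j))"
    using P \<rho>(1) by (auto simp: prod_complex_def)
  have "\<tau>(k := \<rho> k) \<in> (\<Pi>\<^sub>E j\<in>J. Delta (I j))"
    using \<tau> \<rho>' k by (auto simp: PiE_iff extensional_def)
  moreover have "\<forall>j\<in>J. (\<tau>(k := \<rho> k)) j \<subseteq> \<rho> j"
    using le \<rho>(2) by (auto simp: omit_factor_def)
  ultimately have "\<tau>(k := \<rho> k) \<in> P"
    using P \<rho>(1) by (simp add: prod_complex_def)
  moreover have "omit_factor J k (\<tau>(k := \<rho> k)) = \<tau>"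
    using \<tau> by (auto simp: omit_factor_def PiE_iff extensional_def fun_eq_iff)
  ultimately show "\<tau> \<in> dowkerian_quotient J k P"
    unfolding dowkerian_quotient_def by (metis imageI)
qed


section \<open>Homotopy equivalences\<close>

text \<open>The library's \<^const>\<open>homotopy_equivalent_space\<close> with the map \<^term>\<open>f\<close> made explicit.\<close>

definition homotopy_equivalence_map :: "'a topology \<Rightarrow> 'b topology \<Rightarrow> ('a \<Rightarrow> 'b) \<Rightarrow> bool" where
  "homotopy_equivalence_map X Y f \<longleftrightarrow>
     continuous_map X Y f \<and>
     (\<exists>g. continuous_map Y X g \<and>
          homotopic_with (\<lambda>x. True) X X (g \<circ> f) id \<and>
          homotopic_with (\<lambda>x. True) Y Y (f \<circ> g) id)"

lemma homotopy_equivalent_space_iff_map: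
  "X homotopy_equivalent_space Y \<longleftrightarrow> (\<exists>f. homotopy_equivalence_map X Y f)"
  by (auto simp: homotopy_equivalent_space_def homotopy_equivalence_map_def)

end

theory Submission
  imports Defs
begin

text \<open>
  Let \<open>P\<close> be the Dowker product and \<open>Q\<close> its quotient. The fibre of the projection over an interior point
  of a cell \<open>|\<tau>|\<close> is the full simplex on \<open>W \<tau>\<close>, the set of all \<open>i\<close> such that \<open>\<tau>\<close> and \<open>{i}\<close> together
  form a prod-simplex of \<open>P\<close>. So all fibres are contractible, but there need not be a continuous
  section: \<open>W\<close> reverses inclusions, hence a vertex of \<open>Q\<close> may lie in two edges whose sets \<open>W\<close> are
  disjoint.

  The remedy is to move the base point first, factor by factor. For a point \<open>x\<close> of a simplex, \<^emph>\<open>concentrate x\<close> keeps only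
  the vertices whose weight exceeds half of \<open>\<Sum>\<^sub>i x\<^sub>i\<^sup>2\<close>. This is continuous, stays in the carrier of \<open>x\<close>,
  and is homotopic to the identity along segments. It leaves a gap between the carrier of
  \<open>concentrate x\<close> and the carrier of \<open>x\<close>. Choose for each \<open>\<tau> \<in> Q\<close> a vertex \<open>apex \<tau> \<in> W \<tau>\<close>. Let the
  vertices of \<open>x\<close> be selected independently at random, with probabilities that are \<open>1\<close> on the carrier of
  \<open>concentrate x\<close> and fall to \<open>0\<close> as the weight does. The selected vertices form a random
  \<open>\<sigma>\<close> between the two carriers, and the expected value of the vertex \<open>apex \<sigma>\<close> is the point
  \<open>mean_vertex x\<close>. It depends continuously on \<open>x\<close>, and since \<open>W\<close> reverses inclusions it lies in
  the simplex on \<open>W (carrier (concentrate x))\<close>. Therefore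
  \<open>g x = (concentrate x, mean_vertex x)\<close> is a map from \<open>|Q|\<close> to \<open>|P|\<close>.

  The composite of \<open>g\<close> with the projection is \<open>concentrate\<close>, which is homotopic to the identity
  (\<open>homotopic_with_slide\<close>). The other composite sends \<open>(x, y)\<close> to \<open>(concentrate x, mean_vertex x)\<close>.
  The identity is joined to it by sliding first \<open>x\<close> to \<open>concentrate x\<close>
  and then \<open>y\<close> to \<open>mean_vertex x\<close> (\<open>homotopic_straighten\<close>). The second segment stays in \<open>|P|\<close> because
  all its vertices lie in \<open>W (carrier (concentrate x))\<close> and a Dowker product contains the join of a cell with
  any finite set of such vertices; the locale \<open>full_direction\<close> isolates this property.

  The topological work is in \<open>continuous_map_prod_realization\<close>: a homotopy between realizations is
  continuous as soon as on each cell its barycentric coordinates are continuous and only finitely many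
  of them are non-zero. After that, continuity is a matter of real-valued functions.
\<close>

section \<open>Maps from and to coherent topologies\<close>

text \<open>Forming the product with a locally compact Hausdorff space commutes with coherent topologies.
  This is what makes homotopies on a realization definable cell by cell. The proof is the tube lemma:
  if a compact neighbourhood \<open>K\<close> of \<open>t\<close> satisfies \<open>K \<times> {x} \<subseteq> W\<close>, then the \<open>y\<close> with \<open>K \<times> {y} \<subseteq> W\<close> form
  a set that is open in every member of the family, because projecting along \<open>K\<close> is a closed map.\<close>
lemma continuous_map_from_prod_coherent_topology:
  assumes T: "locally_compact_space T" "Hausdorff_space T"
    and C: "\<Union>\<C> \<subseteq> topspace X"
    and h: "\<And>A. A \<in> \<C> \<Longrightarrow> continuous_map (prod_topology T (subtopology X A)) Y h"
  shows "continuous_map (prod_topology T (coherent_topology X \<C>)) Y h"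
  unfolding continuous_map_def
proof (intro conjI allI impI)
  have top: "topspace (subtopology X A) = A" if "A \<in> \<C>" for A
    using C that by auto
  show "h \<in> topspace (prod_topology T (coherent_topology X \<C>)) \<rightarrow> topspace Y"
  proof
    fix z assume z: "z \<in> topspace (prod_topology T (coherent_topology X \<C>))"
    then obtain A where A: "A \<in> \<C>" "snd z \<in> A"
      by (auto simp: topspace_coherent_topology[OF C])
    then have "z \<in> topspace (prod_topology T (subtopology X A))"
      using z unfolding topspace_prod_topology top[OF A(1)] by auto
    then show "h z \<in> topspace Y"
      using continuous_map_image_subset_topspace[OF h[OF A(1)]] by blast
  qed
  fix U assume U: "openin Y U"
  define W where "W = {z \<in> topspace T \<times> \<Union>\<C>. h z \<in> U}"
  have W_cell: "openin (prod_topology T (subtopology X A)) (W \<inter> topspace T \<times> A)" if "A \<in> \<C>" for A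
  proof -
    have "W \<inter> topspace T \<times> A = {z \<in> topspace (prod_topology T (subtopology X A)). h z \<in> U}"
      unfolding topspace_prod_topology top[OF that] W_def using that by auto
    then show ?thesis
      using openin_continuous_map_preimage[OF h[OF that] U] by simp
  qed
  have "openin (prod_topology T (coherent_topology X \<C>)) W"
    unfolding openin_prod_topology_alt
  proof (intro allI impI)
    fix t x assume tx: "(t, x) \<in> W"
    then obtain A where A: "A \<in> \<C>" "x \<in> A" and t: "t \<in> topspace T"
      by (auto simp: W_def)
    have "continuous_map T (prod_topology T (subtopology X A)) (\<lambda>s. (s, x))"
      using A C by (auto simp: continuous_map_pairwise o_def)
    from openin_continuous_map_preimage[OF this W_cell[OF A(1)]]
    have slice: "openin T {s \<in> topspace T. (s, x) \<in> W}"
      by (rule back_subst[where P = "openin T"]) (use A in auto)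
    then obtain N K where NK: "openin T N" "compactin T K" "t \<in> N" "N \<subseteq> K" "K \<subseteq> {s \<in> topspace T. (s, x) \<in> W}"
    proof -
      have "t \<in> {s \<in> topspace T. (s, x) \<in> W}" using tx t by simp
      then show ?thesis
        using that T(1) slice unfolding locally_compact_space_neighbourhood_base[OF disjI1[OF T(2)]] neighbourhood_base_of
        by (metis (no_types, lifting))
    qed
    \<comment> \<open>The tube around \<^term>\<open>x\<close>.\<close>
    define V where "V = {y \<in> \<Union>\<C>. K \<times> {y} \<subseteq> W}"
    have "openin (coherent_topology X \<C>) V"
      unfolding openin_coherent_topology
    proof (intro conjI ballI)
      show "V \<subseteq> \<Union>\<C>" by (auto simp: V_def)
      fix B assume B: "B \<in> \<C>"
      let ?P = "prod_topology (subtopology T K) (subtopology X B)"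
      have K: "K \<subseteq> topspace T" using NK by auto
      have "openin ?P (K \<times> B \<inter> W)"
      proof -
        have "?P = subtopology (prod_topology T (subtopology X B)) (K \<times> topspace (subtopology X B))"
          by (simp add: subtopology_Times del: topspace_subtopology)
        moreover have "openin \<dots> ((W \<inter> topspace T \<times> B) \<inter> K \<times> topspace (subtopology X B))"
          by (rule openin_subtopology_Int) (rule W_cell[OF B])
        moreover have "(W \<inter> topspace T \<times> B) \<inter> K \<times> topspace (subtopology X B) = K \<times> B \<inter> W"
          unfolding top[OF B] using K by auto
        ultimately show ?thesis by (simp only:)
      qed
      then have "closedin ?P (K \<times> B - W)"
      proof -
        have "topspace ?P = K \<times> B" using K C B by auto
        moreover have "K \<times> B - (K \<times> B - W) = K \<times> B \<inter> W" by blast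
        ultimately show ?thesis
          using \<open>openin ?P (K \<times> B \<inter> W)\<close> unfolding closedin_def by auto
      qed
      moreover have "closed_map ?P (subtopology X B) snd"
        using NK(2) by (intro closed_map_snd) (simp add: compact_space_subtopology)
      ultimately have "closedin (subtopology X B) (snd ` (K \<times> B - W))"
        by (simp add: closed_map_def)
      moreover have "V \<inter> B = B - snd ` (K \<times> B - W)"
      proof (intro set_eqI iffI)
        fix y assume "y \<in> V \<inter> B"
        then show "y \<in> B - snd ` (K \<times> B - W)" by (auto simp: V_def)
      next
        fix y assume y: "y \<in> B - snd ` (K \<times> B - W)"
        then have "(s, y) \<in> W" if "s \<in> K" for s using that by (metis DiffD1 DiffD2 DiffI SigmaI imageI snd_conv)
        then show "y \<in> V \<inter> B" using y B by (auto simp: V_def)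
      qed
      ultimately show "openin (subtopology X B) (V \<inter> B)"
        by (metis closedin_def top[OF B])
    qed
    moreover have "x \<in> V" using A NK(5) by (auto simp: V_def)
    moreover have "N \<times> V \<subseteq> W" using NK(4) by (auto simp: V_def)
    ultimately show "\<exists>U V. openin T U \<and> openin (coherent_topology X \<C>) V \<and> t \<in> U \<and> x \<in> V \<and> U \<times> V \<subseteq> W"
      using NK by blast
  qed
  then show "openin (prod_topology T (coherent_topology X \<C>))
         {z \<in> topspace (prod_topology T (coherent_topology X \<C>)). h z \<in> U}"
    by (simp add: W_def topspace_coherent_topology[OF C])
qed

text \<open>The coherent topology may be strictly finer than that of \<open>X\<close>, but the two agree on a finite
  union of closed members of the family.\<close>
lemma continuous_map_into_coherent_topology:
  assumes C: "\<Union>\<C> \<subseteq> topspace X"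
    and B: "finite \<B>" "\<B> \<subseteq> \<C>" "\<And>A. A \<in> \<B> \<Longrightarrow> closedin X A"
    and h: "continuous_map Z X h" "h ` topspace Z \<subseteq> \<Union>\<B>"
  shows "continuous_map Z (coherent_topology X \<C>) h"
  unfolding continuous_map_closedin topspace_coherent_topology[OF C]
proof (intro conjI funcsetI allI impI)
  show "h x \<in> \<Union>\<C>" if "x \<in> topspace Z" for x using that h B by blast
  fix S assume S: "closedin (coherent_topology X \<C>) S"
  have "closedin X (S \<inter> A)" if "A \<in> \<B>" for A
    using S B that unfolding closedin_coherent_topology[OF C]
    by (meson closedin_trans_full subsetD)
  then have "closedin X (\<Union>A\<in>\<B>. S \<inter> A)"
    using B by (intro closedin_Union) auto
  then have "closedin Z {x \<in> topspace Z. h x \<in> (\<Union>A\<in>\<B>. S \<inter> A)}"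
    by (rule closedin_continuous_map_preimage[OF h(1)])
  then show "closedin Z {x \<in> topspace Z. h x \<in> S}"
    by (rule back_subst[where P = "closedin Z"]) (use h(2) in auto)
qed

section \<open>Barycentric coordinates\<close>

lemma lookup_scaleR [simp]: "Poly_Mapping.lookup (r *\<^sub>R x) i = r * Poly_Mapping.lookup x i"
  for x :: "'a \<Rightarrow>\<^sub>0 real"
  by (simp add: scaleR_poly_mapping_def)

lemma lookup_basis_vec: "Poly_Mapping.lookup (basis_vec i) j = (if i = j then 1 else 0)"
  by (simp add: basis_vec_def lookup_single when_def)

lemma poly_mapping_basis_expansion:
  assumes "finite F" "Poly_Mapping.keys x \<subseteq> F"
  shows "(\<Sum>i\<in>F. Poly_Mapping.lookup x i *\<^sub>R basis_vec i) = x"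
proof (rule poly_mapping_eqI)
  fix j
  have "Poly_Mapping.lookup (\<Sum>i\<in>F. Poly_Mapping.lookup x i *\<^sub>R basis_vec i) j
      = (\<Sum>i\<in>F. if i = j then Poly_Mapping.lookup x i else 0)"
    unfolding lookup_sum lookup_scaleR lookup_basis_vec by (intro sum.cong) auto
  also have "\<dots> = (if j \<in> F then Poly_Mapping.lookup x j else 0)"
    using assms(1) by simp
  also have "\<dots> = Poly_Mapping.lookup x j"
    using assms(2) by (auto simp: in_keys_iff)
  finally show "Poly_Mapping.lookup (\<Sum>i\<in>F. Poly_Mapping.lookup x i *\<^sub>R basis_vec i) j
      = Poly_Mapping.lookup x j" .
qed

lemma continuous_on_lookup: "continuous_on UNIV (\<lambda>x::'a \<Rightarrow>\<^sub>0 real. Poly_Mapping.lookup x i)"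
proof -
  have le: "\<bar>Poly_Mapping.lookup x i - Poly_Mapping.lookup y i\<bar> \<le> dist x y" for x y :: "'a \<Rightarrow>\<^sub>0 real"
  proof (cases "i \<in> Poly_Mapping.keys x \<union> Poly_Mapping.keys y")
    case True
    then show ?thesis
      unfolding dist_poly_mapping_def dist_real_def
      by (intro member_le_sum) auto
  qed (auto simp: in_keys_iff)
  show ?thesis
    unfolding continuous_on_iff dist_real_def using le le_less_trans by blast
qed

text \<open>The direct limit topology is finer than the norm topology, in which coordinates are continuous.\<close>
lemma continuous_map_lookup_real_space:
  "continuous_map (real_space I) euclideanreal (\<lambda>x. Poly_Mapping.lookup x i)"
proof -
  have "continuous_map (real_space I) euclidean id"
    unfolding continuous_map_closedin
  proof (intro conjI funcsetI allI impI)
    fix S :: "('a \<Rightarrow>\<^sub>0 real) set" assume "closedin euclidean S"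
    then have "closedin (top_of_set (finsupp_on F)) (finsupp_on I \<inter> S \<inter> finsupp_on F)" if "F \<subseteq> I" for F
      using that unfolding closedin_closed by (intro exI[of _ S]) (auto simp: finsupp_on_def)
    moreover have "{x \<in> topspace (real_space I). id x \<in> S} = finsupp_on I \<inter> S"
      by (auto simp: topspace_real_space)
    ultimately show "closedin (real_space I) {x \<in> topspace (real_space I). id x \<in> S}"
      by (simp add: closedin_real_space)
  qed simp
  moreover have "continuous_map euclidean euclideanreal (\<lambda>x::'a \<Rightarrow>\<^sub>0 real. Poly_Mapping.lookup x i)"
    using continuous_on_lookup by simp
  ultimately have "continuous_map (real_space I) euclideanreal ((\<lambda>x. Poly_Mapping.lookup x i) \<circ> id)"
    by (rule continuous_map_compose)
  then show ?thesis
    by (simp only: o_id)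
qed

text \<open>Conversely, continuity of the coordinates suffices when the map has its values in one
  finite-dimensional subspace, where the direct limit topology is the norm topology.\<close>
lemma continuous_map_into_real_space:
  assumes F: "finite F" "F \<subseteq> I"
    and supp: "\<And>z. z \<in> topspace Z \<Longrightarrow> Poly_Mapping.keys (f z) \<subseteq> F"
    and coord: "\<And>i. i \<in> F \<Longrightarrow> continuous_map Z euclideanreal (\<lambda>z. Poly_Mapping.lookup (f z) i)"
  shows "continuous_map Z (real_space I) f"
proof -
  have "continuous_map Z euclidean (\<lambda>z. Poly_Mapping.lookup (f z) i *\<^sub>R basis_vec i)" if "i \<in> F" for i
  proof -
    have "continuous_map euclideanreal euclidean (\<lambda>r. r *\<^sub>R (basis_vec i :: 'a \<Rightarrow>\<^sub>0 real))"
      by (simp add: continuous_intros)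
    from continuous_map_compose[OF coord[OF that] this] show ?thesis by (simp add: o_def)
  qed
  then have "continuous_map Z euclidean (\<lambda>z. \<Sum>i\<in>F. Poly_Mapping.lookup (f z) i *\<^sub>R basis_vec i)"
    using F by (intro continuous_map_sum) auto
  then have f: "continuous_map Z euclidean f"
    by (rule continuous_map_eq) (rule poly_mapping_basis_expansion[OF F(1) supp])
  show ?thesis
    unfolding continuous_map_closedin topspace_real_space
  proof (intro conjI funcsetI allI impI)
    show "f z \<in> finsupp_on I" if "z \<in> topspace Z" for z
      using supp[OF that] F by (auto simp: finsupp_on_def)
    fix S assume "closedin (real_space I) S"
    then obtain S' where S': "closed S'" "S \<inter> finsupp_on F = finsupp_on F \<inter> S'"
      using F unfolding closedin_real_space closedin_closed by blast
    have "closedin Z {z \<in> topspace Z. f z \<in> S'}"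
      by (rule closedin_continuous_map_preimage[OF f]) (use S' in simp)
    moreover have "{z \<in> topspace Z. f z \<in> S'} = {z \<in> topspace Z. f z \<in> S}"
      using S'(2) supp unfolding finsupp_on_def by blast
    ultimately show "closedin Z {z \<in> topspace Z. f z \<in> S}" by simp
  qed
qed

lemma geom_simplex_eq:
  assumes "finite \<sigma>"
  shows "geom_simplex \<sigma> = {x. Poly_Mapping.keys x \<subseteq> \<sigma> \<and> (\<forall>i. 0 \<le> Poly_Mapping.lookup x i) \<and>
           (\<Sum>i\<in>\<sigma>. Poly_Mapping.lookup x i) = 1}" (is "_ = ?S")
proof
  have "convex ?S"
    unfolding convex_def
  proof (clarify, intro conjI allI)
    fix x y :: "'a \<Rightarrow>\<^sub>0 real" and u v :: real
    assume xy: "Poly_Mapping.keys x \<subseteq> \<sigma>" "\<forall>i. 0 \<le> Poly_Mapping.lookup x i" "sum (Poly_Mapping.lookup x) \<sigma> = 1"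
        "Poly_Mapping.keys y \<subseteq> \<sigma>" "\<forall>i. 0 \<le> Poly_Mapping.lookup y i" "sum (Poly_Mapping.lookup y) \<sigma> = 1"
      and uv: "0 \<le> u" "0 \<le> v" "u + v = 1"
    show "Poly_Mapping.keys (u *\<^sub>R x + v *\<^sub>R y) \<subseteq> \<sigma>"
      using convexD[OF convex_finsupp_on[of \<sigma>], of x y u v] xy uv by (simp add: finsupp_on_def)
    show "0 \<le> Poly_Mapping.lookup (u *\<^sub>R x + v *\<^sub>R y) i" for i
      using xy uv by (simp add: lookup_add)
    show "sum (Poly_Mapping.lookup (u *\<^sub>R x + v *\<^sub>R y)) \<sigma> = 1"
    proof -
      have "sum (Poly_Mapping.lookup (u *\<^sub>R x + v *\<^sub>R y)) \<sigma>
          = u * sum (Poly_Mapping.lookup x) \<sigma> + v * sum (Poly_Mapping.lookup y) \<sigma>"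
        unfolding lookup_add lookup_scaleR sum.distrib sum_distrib_left ..
      then show ?thesis unfolding xy(3,6) using uv by simp
    qed
  qed
  then show "geom_simplex \<sigma> \<subseteq> ?S"
    unfolding geom_simplex_def
  proof (intro hull_minimal image_subsetI)
    fix i assume i: "i \<in> \<sigma>"
    have "(\<Sum>j\<in>\<sigma>. Poly_Mapping.lookup (basis_vec i) j) = 1"
    proof -
      have "(\<Sum>j\<in>\<sigma>. Poly_Mapping.lookup (basis_vec i) j) = (\<Sum>j\<in>\<sigma>. if i = j then 1 else 0)"
        by (intro sum.cong) (simp_all add: lookup_basis_vec)
      then show ?thesis using assms i by simp
    qed
    moreover have "0 \<le> Poly_Mapping.lookup (basis_vec i) j" for j
      by (simp add: lookup_basis_vec)
    moreover have "Poly_Mapping.keys (basis_vec i) \<subseteq> \<sigma>"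
      using i by (simp add: basis_vec_def)
    ultimately show "basis_vec i \<in> ?S"
      by blast
  qed
  show "?S \<subseteq> geom_simplex \<sigma>"
  proof clarify
    fix x :: "'a \<Rightarrow>\<^sub>0 real"
    assume x: "Poly_Mapping.keys x \<subseteq> \<sigma>" "\<forall>i. 0 \<le> Poly_Mapping.lookup x i" "sum (Poly_Mapping.lookup x) \<sigma> = 1"
    have "(\<Sum>i\<in>\<sigma>. Poly_Mapping.lookup x i *\<^sub>R basis_vec i) \<in> geom_simplex \<sigma>"
      unfolding geom_simplex_def
    proof (rule convex_sum[OF assms convex_convex_hull x(3)])
      show "0 \<le> Poly_Mapping.lookup x i" for i using x(2) by blast
      show "basis_vec i \<in> convex hull basis_vec ` \<sigma>" if "i \<in> \<sigma>" for i
        by (rule hull_inc) (rule imageI[OF that])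
    qed
    then show "x \<in> geom_simplex \<sigma>"
      unfolding poly_mapping_basis_expansion[OF assms x(1)] .
  qed
qed

text \<open>Membership in a simplex splits into a bound on the carrier and a condition that does not
  mention the simplex.\<close>
lemma geom_simplex_iff_keys:
  assumes "finite \<sigma>"
  shows "x \<in> geom_simplex \<sigma> \<longleftrightarrow> Poly_Mapping.keys x \<subseteq> \<sigma> \<and> x \<in> geom_simplex (Poly_Mapping.keys x)"
proof (cases "Poly_Mapping.keys x \<subseteq> \<sigma>")
  case True
  then have "(\<Sum>i\<in>\<sigma>. Poly_Mapping.lookup x i) = (\<Sum>i\<in>Poly_Mapping.keys x. Poly_Mapping.lookup x i)"
    using assms by (intro sum.mono_neutral_right) (auto simp: in_keys_iff)
  then show ?thesis using True assms by (simp add: geom_simplex_eq)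
qed (use assms in \<open>simp add: geom_simplex_eq\<close>)

lemma closedin_geom_simplex:
  assumes "finite \<sigma>" "\<sigma> \<subseteq> I"
  shows "closedin (real_space I) (geom_simplex \<sigma>)"
proof -
  define A where "A i = {x \<in> topspace (real_space I).
      Poly_Mapping.lookup x i \<in> (if i \<in> \<sigma> then {0..} else {0})}" for i
  define B where "B = {x \<in> topspace (real_space I). (\<Sum>i\<in>\<sigma>. Poly_Mapping.lookup x i) \<in> {1}}"
  have "closedin (real_space I) (A i)" for i
    unfolding A_def
    by (rule closedin_continuous_map_preimage[OF continuous_map_lookup_real_space]) simp
  then have "closedin (real_space I) (\<Inter>i. A i)"
    by (intro closedin_INT) auto
  moreover have "continuous_map (real_space I) euclideanreal (\<lambda>x. \<Sum>i\<in>\<sigma>. Poly_Mapping.lookup x i)"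
    using assms(1) by (intro continuous_map_sum continuous_map_lookup_real_space)
  then have "closedin (real_space I) B"
    unfolding B_def by (rule closedin_continuous_map_preimage) simp
  moreover have eq: "geom_simplex \<sigma> = (\<Inter>i. A i) \<inter> B"
  proof (intro set_eqI iffI)
    fix x assume "x \<in> geom_simplex \<sigma>"
    then show "x \<in> (\<Inter>i. A i) \<inter> B"
      unfolding A_def B_def topspace_real_space geom_simplex_eq[OF assms(1)] using assms(2)
      by (fastforce simp: finsupp_on_def in_keys_iff)
  next
    fix x assume x: "x \<in> (\<Inter>i. A i) \<inter> B"
    then have "x \<in> A i" for i by blast
    then have sgn: "Poly_Mapping.lookup x i \<in> (if i \<in> \<sigma> then {0..} else {0})" for i
      by (simp add: A_def)
    have "0 \<le> Poly_Mapping.lookup x i" for i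
      using sgn[of i] by (cases "i \<in> \<sigma>") simp_all
    moreover have "Poly_Mapping.lookup x i = 0" if "i \<notin> \<sigma>" for i
      using sgn[of i] that by simp
    moreover have "(\<Sum>i\<in>\<sigma>. Poly_Mapping.lookup x i) = 1"
      using x by (simp add: B_def)
    ultimately show "x \<in> geom_simplex \<sigma>"
      unfolding geom_simplex_eq[OF assms(1)] by (auto simp: in_keys_iff)
  qed
  ultimately show ?thesis
    unfolding eq by (intro closedin_Int)
qed

section \<open>Realizations of prod-complexes\<close>

text \<open>The smallest cell containing \<^term>\<open>x\<close>, if \<^term>\<open>x\<close> is a point of a realization.\<close>
definition support :: "nat set \<Rightarrow> (nat \<Rightarrow> 'a \<Rightarrow>\<^sub>0 real) \<Rightarrow> (nat \<Rightarrow> 'a set)" where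
  "support J x = (\<lambda>j\<in>J. Poly_Mapping.keys (x j))"

lemma geom_simplex_keys_nonempty:
  assumes "x \<in> geom_simplex (Poly_Mapping.keys x)"
  shows "Poly_Mapping.keys x \<noteq> {}"
  using assms by (auto simp: geom_simplex_def)

lemma prod_complex_cell:
  assumes "prod_complex J I P" "\<sigma> \<in> P" "j \<in> J"
  shows "finite (\<sigma> j)" "\<sigma> j \<noteq> {}" "\<sigma> j \<subseteq> I j"
proof -
  have "\<sigma> j \<in> Delta (I j)"
    using assms unfolding prod_complex_def by (meson PiE_mem subsetD)
  then show "finite (\<sigma> j)" "\<sigma> j \<noteq> {}" "\<sigma> j \<subseteq> I j"
    by (auto simp: Delta_def Fpow_def)
qed

lemma prod_complex_face:
  assumes P: "prod_complex J I P" "\<sigma> \<in> P"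
    and \<tau>: "\<tau> \<in> extensional J" "\<And>j. j \<in> J \<Longrightarrow> \<tau> j \<noteq> {} \<and> \<tau> j \<subseteq> \<sigma> j"
  shows "\<tau> \<in> P"
proof -
  have "\<tau> j \<in> Delta (I j)" if "j \<in> J" for j
    using \<tau>(2)[OF that] prod_complex_cell[OF P that] finite_subset
    by (auto simp: Delta_def Fpow_def)
  then have "\<tau> \<in> (\<Pi>\<^sub>E j\<in>J. Delta (I j))"
    using \<tau>(1) by (auto simp: PiE_iff)
  then show ?thesis
    using P \<tau>(2) unfolding prod_complex_def by blast
qed

lemma geom_cell_support:
  assumes "\<And>j. j \<in> J \<Longrightarrow> finite (\<sigma> j)" "x \<in> geom_cell J \<sigma>"
  shows "x \<in> geom_cell J (support J x)"
    and "j \<in> J \<Longrightarrow> x j \<in> geom_simplex (Poly_Mapping.keys (x j)) \<and> Poly_Mapping.keys (x j) \<subseteq> \<sigma> j"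
proof -
  show *: "x j \<in> geom_simplex (Poly_Mapping.keys (x j)) \<and> Poly_Mapping.keys (x j) \<subseteq> \<sigma> j"
    if "j \<in> J" for j
    using assms(2) geom_simplex_iff_keys[OF assms(1)[OF that], of "x j"] that
    by (auto simp: geom_cell_def PiE_iff)
  show "x \<in> geom_cell J (support J x)"
    using * assms(2) by (auto simp: geom_cell_def support_def PiE_iff)
qed

lemma support_realization:
  assumes P: "prod_complex J I P" and x: "x \<in> topspace (realization J I P)"
  shows "support J x \<in> P" "x \<in> geom_cell J (support J x)"
proof -
  obtain \<sigma> where \<sigma>: "\<sigma> \<in> P" "x \<in> geom_cell J \<sigma>"
    using x topspace_realization[OF P] by blast
  note fin = prod_complex_cell(1)[OF P \<sigma>(1)]
  show "x \<in> geom_cell J (support J x)"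
    using geom_cell_support(1)[OF fin \<sigma>(2)] by blast
  show "support J x \<in> P"
  proof (rule prod_complex_face[OF P \<sigma>(1)])
    show "support J x \<in> extensional J" by (simp add: support_def)
    show "support J x j \<noteq> {} \<and> support J x j \<subseteq> \<sigma> j" if "j \<in> J" for j
      using geom_cell_support(2)[OF fin \<sigma>(2) that] geom_simplex_keys_nonempty[of "x j"] that
      by (simp add: support_def)
  qed
qed

lemma continuous_map_barycentric_coordinate:
  assumes "j \<in> J"
  shows "continuous_map (subtopology (product_topology (\<lambda>j. real_space (I j)) J) A) euclideanreal
           (\<lambda>x. Poly_Mapping.lookup (x j) i)"
proof -
  have "continuous_map (product_topology (\<lambda>j. real_space (I j)) J) euclideanreal
          ((\<lambda>x. Poly_Mapping.lookup x i) \<circ> (\<lambda>x. x j))"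
    by (rule continuous_map_compose[OF continuous_map_product_projection[OF assms]
          continuous_map_lookup_real_space])
  then show ?thesis
    unfolding o_def by (rule continuous_map_from_subtopology)
qed

lemma closedin_geom_cell:
  assumes "prod_complex J I P" "\<sigma> \<in> P"
  shows "closedin (product_topology (\<lambda>j. real_space (I j)) J) (geom_cell J \<sigma>)"
  unfolding geom_cell_def closedin_product_topology
  by (intro disjI2 ballI closedin_geom_simplex prod_complex_cell[OF assms])

text \<open>Each cell of the domain must be mapped into a finite set \<^term>\<open>F \<sigma> j\<close> of vertices per factor,
  not into a single cell: its image may meet several cells, but only those with
  all vertices in \<^term>\<open>F \<sigma>\<close>, and they form a finite family of closed sets.\<close>
lemma continuous_map_prod_realization:
  assumes T: "locally_compact_space T" "Hausdorff_space T"
    and P: "prod_complex J I P" and Q: "prod_complex J' I' Q" and J': "finite J'"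
    and fin: "\<And>\<sigma> j. \<sigma> \<in> P \<Longrightarrow> j \<in> J' \<Longrightarrow> finite (F \<sigma> j)"
    and mem: "\<And>\<sigma> t x. \<lbrakk>\<sigma> \<in> P; t \<in> topspace T; x \<in> geom_cell J \<sigma>\<rbrakk>
          \<Longrightarrow> h (t, x) \<in> topspace (realization J' I' Q)"
    and supp: "\<And>\<sigma> t x j. \<lbrakk>\<sigma> \<in> P; t \<in> topspace T; x \<in> geom_cell J \<sigma>; j \<in> J'\<rbrakk>
          \<Longrightarrow> Poly_Mapping.keys (h (t, x) j) \<subseteq> F \<sigma> j"
    and coord: "\<And>\<sigma> j i. \<lbrakk>\<sigma> \<in> P; j \<in> J'; i \<in> F \<sigma> j\<rbrakk> \<Longrightarrow>
          continuous_map
            (prod_topology T (subtopology (product_topology (\<lambda>j. real_space (I j)) J) (geom_cell J \<sigma>)))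
            euclideanreal (\<lambda>z. Poly_Mapping.lookup (h z j) i)"
  shows "continuous_map (prod_topology T (realization J I P)) (realization J' I' Q) h"
  unfolding realization_def[of J I P]
proof (rule continuous_map_from_prod_coherent_topology[OF T geom_cells_subset[OF P]])
  fix A assume "A \<in> geom_cell J ` P"
  then obtain \<sigma> where \<sigma>: "\<sigma> \<in> P" "A = geom_cell J \<sigma>" by blast
  let ?X = "product_topology (\<lambda>j. real_space (I j)) J"
  let ?Z = "prod_topology T (subtopology ?X A)"
  have top_Z: "topspace ?Z = topspace T \<times> A"
  proof -
    have "A \<subseteq> topspace ?X"
      using geom_cells_subset[OF P] \<open>A \<in> geom_cell J ` P\<close> by (rule order_trans[OF Union_upper, rotated])
    then have "topspace ?X \<inter> A = A" by (rule Int_absorb1)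
    then show ?thesis by (simp only: topspace_prod_topology topspace_subtopology)
  qed
  have point: "h z \<in> topspace (realization J' I' Q)" "j \<in> J' \<Longrightarrow> Poly_Mapping.keys (h z j) \<subseteq> F \<sigma> j"
    if "z \<in> topspace ?Z" for z j
  proof -
    obtain t x where "z = (t, x)" "t \<in> topspace T" "x \<in> geom_cell J \<sigma>"
      using \<open>z \<in> topspace ?Z\<close>[unfolded top_Z] \<sigma>(2) by blast
    then show "h z \<in> topspace (realization J' I' Q)"
      "j \<in> J' \<Longrightarrow> Poly_Mapping.keys (h z j) \<subseteq> F \<sigma> j"
      using mem[OF \<sigma>(1)] supp[OF \<sigma>(1)] by blast+
  qed
  define \<B> where "\<B> = {\<tau> \<in> Q. \<forall>j\<in>J'. \<tau> j \<subseteq> F \<sigma> j}"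
  have in_\<B>: "support J' (h z) \<in> \<B>" "h z \<in> geom_cell J' (support J' (h z))" if "z \<in> topspace ?Z" for z
  proof -
    have "support J' (h z) j \<subseteq> F \<sigma> j" if "j \<in> J'" for j
      using point(2)[OF \<open>z \<in> topspace ?Z\<close> that] that by (simp add: support_def)
    then show "support J' (h z) \<in> \<B>" "h z \<in> geom_cell J' (support J' (h z))"
      using support_realization[OF Q point(1)[OF that]] unfolding \<B>_def by blast+
  qed
  show "continuous_map ?Z (realization J' I' Q) h"
    unfolding realization_def
  proof (rule continuous_map_into_coherent_topology[OF geom_cells_subset[OF Q], of "geom_cell J' ` \<B>"])
    have "\<B> \<subseteq> (\<Pi>\<^sub>E j\<in>J'. Pow (F \<sigma> j))"
      using Q unfolding \<B>_def prod_complex_def PiE_iff by blast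
    then have "finite \<B>"
      by (rule finite_subset) (use J' fin[OF \<sigma>(1)] in \<open>auto intro!: finite_PiE\<close>)
    then show "finite (geom_cell J' ` \<B>)" by (rule finite_imageI)
    show "geom_cell J' ` \<B> \<subseteq> geom_cell J' ` Q" by (auto simp: \<B>_def)
    show "closedin (product_topology (\<lambda>j. real_space (I' j)) J') C" if "C \<in> geom_cell J' ` \<B>" for C
      using that closedin_geom_cell[OF Q] by (auto simp: \<B>_def)
    show "h ` topspace ?Z \<subseteq> \<Union> (geom_cell J' ` \<B>)"
      using in_\<B> by blast
    show "continuous_map ?Z (product_topology (\<lambda>j. real_space (I' j)) J') h"
      unfolding continuous_map_componentwise
    proof (intro conjI ballI)
      show "h ` topspace ?Z \<subseteq> extensional J'"
        using in_\<B>(2) unfolding geom_cell_def PiE_iff by blast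
      fix j assume j: "j \<in> J'"
      show "continuous_map ?Z (real_space (I' j)) (\<lambda>z. h z j)"
      proof (rule continuous_map_into_real_space[of "F \<sigma> j \<inter> I' j"])
        show "finite (F \<sigma> j \<inter> I' j)" using fin[OF \<sigma>(1) j] by blast
        show "F \<sigma> j \<inter> I' j \<subseteq> I' j" by blast
        show "Poly_Mapping.keys (h z j) \<subseteq> F \<sigma> j \<inter> I' j" if "z \<in> topspace ?Z" for z
        proof -
          have "support J' (h z) \<in> Q" using in_\<B>(1)[OF that] by (simp add: \<B>_def)
          from prod_complex_cell(3)[OF Q this j] have "Poly_Mapping.keys (h z j) \<subseteq> I' j"
            using j by (simp add: support_def)
          then show ?thesis using point(2)[OF that j] by blast
        qed
        show "continuous_map ?Z euclideanreal (\<lambda>z. Poly_Mapping.lookup (h z j) i)"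
          if "i \<in> F \<sigma> j \<inter> I' j" for i
          using coord[OF \<sigma>(1) j, of i] that unfolding \<sigma>(2) by blast
      qed
    qed
  qed
qed

text \<open>The case of a one-point parameter space.\<close>
lemma continuous_map_realization:
  assumes P: "prod_complex J I P" and Q: "prod_complex J' I' Q" and J': "finite J'"
    and fin: "\<And>\<sigma> j. \<sigma> \<in> P \<Longrightarrow> j \<in> J' \<Longrightarrow> finite (F \<sigma> j)"
    and mem: "\<And>\<sigma> x. \<lbrakk>\<sigma> \<in> P; x \<in> geom_cell J \<sigma>\<rbrakk> \<Longrightarrow> f x \<in> topspace (realization J' I' Q)"
    and supp: "\<And>\<sigma> x j. \<lbrakk>\<sigma> \<in> P; x \<in> geom_cell J \<sigma>; j \<in> J'\<rbrakk>
          \<Longrightarrow> Poly_Mapping.keys (f x j) \<subseteq> F \<sigma> j"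
    and coord: "\<And>\<sigma> j i. \<lbrakk>\<sigma> \<in> P; j \<in> J'; i \<in> F \<sigma> j\<rbrakk> \<Longrightarrow>
          continuous_map (subtopology (product_topology (\<lambda>j. real_space (I j)) J) (geom_cell J \<sigma>))
            euclideanreal (\<lambda>x. Poly_Mapping.lookup (f x j) i)"
  shows "continuous_map (realization J I P) (realization J' I' Q) f"
proof -
  let ?T = "discrete_topology {()}"
  have "continuous_map (prod_topology ?T (realization J I P)) (realization J' I' Q) (f \<circ> snd)"
  proof (rule continuous_map_prod_realization[OF _ _ P Q J' fin])
    show "continuous_map
        (prod_topology ?T (subtopology (product_topology (\<lambda>j. real_space (I j)) J) (geom_cell J \<sigma>)))
        euclideanreal (\<lambda>z. Poly_Mapping.lookup ((f \<circ> snd) z j) i)"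
      if "\<sigma> \<in> P" "j \<in> J'" "i \<in> F \<sigma> j" for \<sigma> j i
      using continuous_map_compose[OF continuous_map_snd coord[OF that]] by (simp add: o_def)
  qed (use mem supp in \<open>auto simp: locally_compact_space_discrete_topology\<close>)
  moreover have "continuous_map (realization J I P) (prod_topology ?T (realization J I P)) (\<lambda>x. ((), x))"
    by (simp add: continuous_map_pairwise o_def)
  ultimately have "continuous_map (realization J I P) (realization J' I' Q) ((f \<circ> snd) \<circ> (\<lambda>x. ((), x)))"
    by (rule continuous_map_compose[rotated])
  then show ?thesis by (simp add: o_def)
qed

section \<open>Concentrating a point on its heavy vertices\<close>

text \<open>The threshold for heavy vertices has to be a continuous function below the largest coordinate.
  Half the sum of the squares is one: as the coordinates sum to \<open>1\<close>, the sum of the squares is at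
  most the largest of them.\<close>
definition sqnorm :: "('a \<Rightarrow>\<^sub>0 real) \<Rightarrow> real" where
  "sqnorm x = (\<Sum>i\<in>Poly_Mapping.keys x. (Poly_Mapping.lookup x i)\<^sup>2)"

definition excess :: "('a \<Rightarrow>\<^sub>0 real) \<Rightarrow> 'a \<Rightarrow> real" where
  "excess x i = max 0 (Poly_Mapping.lookup x i - sqnorm x / 2)"

definition concentrate :: "('a \<Rightarrow>\<^sub>0 real) \<Rightarrow> ('a \<Rightarrow>\<^sub>0 real)" where
  "concentrate x = (\<Sum>i\<in>Poly_Mapping.keys x.
     (excess x i / (\<Sum>j\<in>Poly_Mapping.keys x. excess x j)) *\<^sub>R basis_vec i)"

text \<open>The probability with which the vertex \<^term>\<open>i\<close> is selected. It reaches \<open>1\<close> exactly at the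
  threshold used by \<^const>\<open>concentrate\<close>, so that every vertex that survives concentration is
  selected with certainty.\<close>
definition level :: "('a \<Rightarrow>\<^sub>0 real) \<Rightarrow> 'a \<Rightarrow> real" where
  "level x i = min 1 (2 * Poly_Mapping.lookup x i / sqnorm x)"

definition simplex_point :: "('a \<Rightarrow>\<^sub>0 real) \<Rightarrow> bool" where
  "simplex_point x \<longleftrightarrow> x \<in> geom_simplex (Poly_Mapping.keys x)"

lemma simplex_pointD:
  assumes "simplex_point x"
  shows "0 \<le> Poly_Mapping.lookup x i" "(\<Sum>i\<in>Poly_Mapping.keys x. Poly_Mapping.lookup x i) = 1"
    "Poly_Mapping.keys x \<noteq> {}"
  using assms geom_simplex_keys_nonempty[of x] by (auto simp: simplex_point_def geom_simplex_eq)

lemma sqnorm_eq: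
  assumes "finite F" "Poly_Mapping.keys x \<subseteq> F"
  shows "sqnorm x = (\<Sum>i\<in>F. (Poly_Mapping.lookup x i)\<^sup>2)"
  unfolding sqnorm_def using assms by (intro sum.mono_neutral_left) (auto simp: in_keys_iff)

lemma sqnorm_nonneg: "0 \<le> sqnorm x"
  unfolding sqnorm_def by (intro sum_nonneg) simp

lemma sqnorm_pos:
  assumes "simplex_point x"
  shows "0 < sqnorm x"
  unfolding sqnorm_def using simplex_pointD(3)[OF assms]
  by (intro sum_pos) (auto simp: in_keys_iff)

lemma excess_eq_0: "i \<notin> Poly_Mapping.keys x \<Longrightarrow> excess x i = 0"
  using sqnorm_nonneg[of x] by (simp add: excess_def in_keys_iff)

lemma sum_excess_eq:
  assumes "finite F" "Poly_Mapping.keys x \<subseteq> F"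
  shows "(\<Sum>i\<in>Poly_Mapping.keys x. excess x i) = (\<Sum>i\<in>F. excess x i)"
  using assms by (intro sum.mono_neutral_left) (auto simp: excess_eq_0)

text \<open>Some coordinate is at least the sum of the squares, since otherwise that sum, being the mean of the
  coordinates with respect to the coordinates as weights, would be smaller than itself.\<close>
lemma sum_excess_pos:
  assumes x: "simplex_point x"
  shows "0 < (\<Sum>i\<in>Poly_Mapping.keys x. excess x i)"
proof -
  have "\<exists>i\<in>Poly_Mapping.keys x. sqnorm x \<le> Poly_Mapping.lookup x i"
  proof (rule ccontr)
    assume "\<not> ?thesis"
    then have less: "Poly_Mapping.lookup x i < sqnorm x" if "i \<in> Poly_Mapping.keys x" for i
      using that by force
    have "sqnorm x < (\<Sum>i\<in>Poly_Mapping.keys x. Poly_Mapping.lookup x i * sqnorm x)"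
      unfolding sqnorm_def[of x] power2_eq_square
    proof (rule sum_strict_mono)
      fix i assume i: "i \<in> Poly_Mapping.keys x"
      then have "0 < Poly_Mapping.lookup x i"
        using simplex_pointD(1)[OF x, of i] by (simp add: in_keys_iff)
      from mult_strict_left_mono[OF less[OF i] this]
      show "Poly_Mapping.lookup x i * Poly_Mapping.lookup x i < Poly_Mapping.lookup x i *
          (\<Sum>i\<in>Poly_Mapping.keys x. Poly_Mapping.lookup x i * Poly_Mapping.lookup x i)"
        unfolding sqnorm_def power2_eq_square .
    qed (use simplex_pointD(3)[OF x] in auto)
    then show False
      using simplex_pointD(2)[OF x] by (simp flip: sum_distrib_right)
  qed
  then obtain i where i: "i \<in> Poly_Mapping.keys x" "sqnorm x \<le> Poly_Mapping.lookup x i" by blast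
  \<comment> \<open>Such a coordinate exceeds the threshold strictly, because \<^term>\<open>sqnorm x\<close> is positive.\<close>
  show ?thesis
  proof (rule sum_pos2[OF _ i(1)])
    show "0 < excess x i" using i(2) sqnorm_pos[OF x] by (simp add: excess_def)
  qed (auto simp: excess_def)
qed

lemma lookup_concentrate:
  "Poly_Mapping.lookup (concentrate x) i = excess x i / (\<Sum>j\<in>Poly_Mapping.keys x. excess x j)"
proof -
  have "Poly_Mapping.lookup (concentrate x) i = (\<Sum>j\<in>Poly_Mapping.keys x.
      if j = i then excess x j / (\<Sum>j\<in>Poly_Mapping.keys x. excess x j) else 0)"
    unfolding concentrate_def lookup_sum lookup_scaleR lookup_basis_vec by (intro sum.cong) auto
  then show ?thesis by (simp add: excess_eq_0)
qed

lemma keys_concentrate: "Poly_Mapping.keys (concentrate x) \<subseteq> Poly_Mapping.keys x"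
proof
  fix i assume "i \<in> Poly_Mapping.keys (concentrate x)"
  then show "i \<in> Poly_Mapping.keys x"
    using excess_eq_0[of i x] by (auto simp: in_keys_iff[of i "concentrate x"] lookup_concentrate)
qed

lemma concentrate_simplex:
  assumes "simplex_point x"
  shows "simplex_point (concentrate x)"
proof -
  have "concentrate x \<in> geom_simplex (Poly_Mapping.keys x)"
    unfolding concentrate_def geom_simplex_def
  proof (rule convex_sum)
    show "(\<Sum>i\<in>Poly_Mapping.keys x. excess x i / (\<Sum>j\<in>Poly_Mapping.keys x. excess x j)) = 1"
      using sum_excess_pos[OF assms] by (simp flip: sum_divide_distrib)
    show "0 \<le> excess x i / (\<Sum>j\<in>Poly_Mapping.keys x. excess x j)" for i
      using sum_excess_pos[OF assms] by (simp add: excess_def)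
  qed (auto intro: hull_inc)
  then show ?thesis
    unfolding simplex_point_def using geom_simplex_iff_keys finite_keys by blast
qed

lemma level_nonneg: "simplex_point x \<Longrightarrow> 0 \<le> level x i"
  using simplex_pointD(1)[of x i] sqnorm_nonneg[of x] by (simp add: level_def)

lemma level_le_1: "level x i \<le> 1"
  by (simp add: level_def)

lemma level_eq_0: "i \<notin> Poly_Mapping.keys x \<Longrightarrow> level x i = 0"
  by (simp add: level_def in_keys_iff)

lemma level_eq_1:
  assumes "simplex_point x" "i \<in> Poly_Mapping.keys (concentrate x)"
  shows "level x i = 1"
proof -
  have "excess x i \<noteq> 0"
    using assms(2) by (auto simp: in_keys_iff lookup_concentrate)
  then have "sqnorm x < 2 * Poly_Mapping.lookup x i"
    by (auto simp: excess_def max_def split: if_splits)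
  then show ?thesis
    using sqnorm_pos[OF assms(1)] by (simp add: level_def)
qed

text \<open>In the continuity proofs the sum over the varying set of keys is replaced by the sum over a fixed finite
  set containing them.\<close>
lemma continuous_map_sqnorm:
  assumes F: "finite F" "\<And>z. z \<in> topspace Z \<Longrightarrow> Poly_Mapping.keys (\<xi> z) \<subseteq> F"
    and coord: "\<And>i. continuous_map Z euclideanreal (\<lambda>z. Poly_Mapping.lookup (\<xi> z) i)"
  shows "continuous_map Z euclideanreal (\<lambda>z. sqnorm (\<xi> z))"
proof (rule continuous_map_eq)
  show "continuous_map Z euclideanreal (\<lambda>z. \<Sum>i\<in>F. (Poly_Mapping.lookup (\<xi> z) i)\<^sup>2)"
    using F(1) coord by (intro continuous_map_sum continuous_map_real_pow)
qed (simp add: sqnorm_eq[OF F(1) F(2)])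

lemma continuous_map_concentrate:
  assumes F: "finite F" "\<And>z. z \<in> topspace Z \<Longrightarrow> simplex_point (\<xi> z) \<and> Poly_Mapping.keys (\<xi> z) \<subseteq> F"
    and coord: "\<And>i. continuous_map Z euclideanreal (\<lambda>z. Poly_Mapping.lookup (\<xi> z) i)"
  shows "continuous_map Z euclideanreal (\<lambda>z. Poly_Mapping.lookup (concentrate (\<xi> z)) i)"
proof -
  note sq = continuous_map_sqnorm[where \<xi> = \<xi>, OF F(1) conjunct2[OF F(2)] coord]
  have excess: "continuous_map Z euclideanreal (\<lambda>z. excess (\<xi> z) i)" for i
    unfolding excess_def
    using sq coord by (intro continuous_map_real_max continuous_map_diff continuous_map_real_divide) auto
  have "continuous_map Z euclideanreal (\<lambda>z. \<Sum>i\<in>Poly_Mapping.keys (\<xi> z). excess (\<xi> z) i)"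
  proof (rule continuous_map_eq)
    show "continuous_map Z euclideanreal (\<lambda>z. \<Sum>i\<in>F. excess (\<xi> z) i)"
      using F(1) excess by (intro continuous_map_sum)
    show "(\<Sum>i\<in>F. excess (\<xi> z) i) = (\<Sum>i\<in>Poly_Mapping.keys (\<xi> z). excess (\<xi> z) i)"
      if "z \<in> topspace Z" for z
      using sum_excess_eq[OF F(1) conjunct2[OF F(2)[OF that]]] ..
  qed
  then show ?thesis
    unfolding lookup_concentrate
    by (rule continuous_map_real_divide[OF excess]) (use F(2) sum_excess_pos in force)
qed

lemma continuous_map_level:
  assumes F: "finite F" "\<And>z. z \<in> topspace Z \<Longrightarrow> simplex_point (\<xi> z) \<and> Poly_Mapping.keys (\<xi> z) \<subseteq> F"
    and coord: "\<And>i. continuous_map Z euclideanreal (\<lambda>z. Poly_Mapping.lookup (\<xi> z) i)"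
  shows "continuous_map Z euclideanreal (\<lambda>z. level (\<xi> z) i)"
proof -
  note sq = continuous_map_sqnorm[where \<xi> = \<xi>, OF F(1) conjunct2[OF F(2)] coord]
  have "sqnorm (\<xi> z) \<noteq> 0" if "z \<in> topspace Z" for z
    using sqnorm_pos F(2)[OF that] by force
  then show ?thesis
    unfolding level_def
    using sq coord
    by (intro continuous_map_real_min continuous_map_real_divide continuous_map_real_mult_left) auto
qed

section \<open>The expected vertex over a random cell\<close>

text \<open>The probability of selecting exactly \<^term>\<open>\<sigma> j\<close> from \<^term>\<open>F j\<close> for all \<^term>\<open>j\<close>, when all vertices are
  selected independently.\<close>
definition weight :: "nat set \<Rightarrow> (nat \<Rightarrow> 'a set) \<Rightarrow> (nat \<Rightarrow> 'a \<Rightarrow>\<^sub>0 real) \<Rightarrow> (nat \<Rightarrow> 'a set) \<Rightarrow> real" where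
  "weight J F x \<sigma> =
     (\<Prod>j\<in>J. (\<Prod>i\<in>\<sigma> j. level (x j) i) * (\<Prod>i\<in>F j - \<sigma> j. 1 - level (x j) i))"

definition mean_vertex :: "nat set \<Rightarrow> ((nat \<Rightarrow> 'a set) \<Rightarrow> 'a) \<Rightarrow> (nat \<Rightarrow> 'a \<Rightarrow>\<^sub>0 real) \<Rightarrow> ('a \<Rightarrow>\<^sub>0 real)" where
  "mean_vertex J w x = (\<Sum>\<sigma>\<in>(\<Pi>\<^sub>E j\<in>J. Pow (Poly_Mapping.keys (x j))).
     weight J (\<lambda>j. Poly_Mapping.keys (x j)) x \<sigma> *\<^sub>R basis_vec (w \<sigma>))"

lemma sum_weight:
  assumes "finite J" "\<And>j. j \<in> J \<Longrightarrow> finite (F j)"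
  shows "(\<Sum>\<sigma>\<in>(\<Pi>\<^sub>E j\<in>J. Pow (F j)). weight J F x \<sigma>) = 1"
proof -
  have "(\<Sum>\<sigma>\<in>(\<Pi>\<^sub>E j\<in>J. Pow (F j)). weight J F x \<sigma>)
      = (\<Prod>j\<in>J. \<Sum>S\<in>Pow (F j). (\<Prod>i\<in>S. level (x j) i) * (\<Prod>i\<in>F j - S. 1 - level (x j) i))"
    unfolding weight_def using assms by (intro prod_sum_PiE[symmetric]) auto
  also have "\<dots> = (\<Prod>j\<in>J. \<Prod>i\<in>F j. level (x j) i + (1 - level (x j) i))"
    using assms by (intro prod.cong refl prod_add[symmetric]) auto
  also have "\<dots> = 1" by simp
  finally show ?thesis .
qed

lemma weight_nonneg:
  assumes "\<And>j. j \<in> J \<Longrightarrow> simplex_point (x j)"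
  shows "0 \<le> weight J F x \<sigma>"
  unfolding weight_def
proof (intro prod_nonneg mult_nonneg_nonneg)
  show "0 \<le> level (x j) i" if "j \<in> J" for i j
    using assms[OF that] by (rule level_nonneg)
  show "0 \<le> 1 - level (x j) i" for i j
    using level_le_1[of "x j" i] by simp
qed

text \<open>Vertices that survive concentration have level \<open>1\<close> and cannot be missed; vertices outside the
  carrier have level \<open>0\<close> and cannot be selected.\<close>
lemma weight_nonzero_sandwiched:
  assumes "finite J" "\<And>j. j \<in> J \<Longrightarrow> finite (F j)" "\<sigma> \<in> (\<Pi>\<^sub>E j\<in>J. Pow (F j))"
    and x: "\<And>j. j \<in> J \<Longrightarrow> simplex_point (x j) \<and> Poly_Mapping.keys (x j) \<subseteq> F j"
    and nz: "weight J F x \<sigma> \<noteq> 0" and j: "j \<in> J"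
  shows "Poly_Mapping.keys (concentrate (x j)) \<subseteq> \<sigma> j" "\<sigma> j \<subseteq> Poly_Mapping.keys (x j)"
proof -
  have "\<sigma> j \<subseteq> F j" using PiE_mem[OF assms(3) j] by simp
  then have fin: "finite (\<sigma> j)" "finite (F j - \<sigma> j)"
    using assms(2)[OF j] finite_subset by simp_all
  have "(\<Prod>i\<in>\<sigma> j. level (x j) i) * (\<Prod>i\<in>F j - \<sigma> j. 1 - level (x j) i) \<noteq> 0"
    using nz[unfolded weight_def prod_zero_iff[OF assms(1)]] j by meson
  then have "(\<Prod>i\<in>\<sigma> j. level (x j) i) \<noteq> 0" "(\<Prod>i\<in>F j - \<sigma> j. 1 - level (x j) i) \<noteq> 0"
    unfolding mult_eq_0_iff de_Morgan_disj by (rule conjunct1, rule conjunct2)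
  then have "\<forall>i\<in>\<sigma> j. level (x j) i \<noteq> 0" "\<forall>i\<in>F j - \<sigma> j. level (x j) i \<noteq> 1"
    unfolding prod_zero_iff[OF fin(1)] prod_zero_iff[OF fin(2)] by simp_all
  note level = this
  show "\<sigma> j \<subseteq> Poly_Mapping.keys (x j)"
  proof
    fix i assume "i \<in> \<sigma> j"
    with level(1) have "level (x j) i \<noteq> 0" by (rule bspec)
    then show "i \<in> Poly_Mapping.keys (x j)" by (rule contrapos_np) (rule level_eq_0)
  qed
  show "Poly_Mapping.keys (concentrate (x j)) \<subseteq> \<sigma> j"
  proof
    fix i assume i: "i \<in> Poly_Mapping.keys (concentrate (x j))"
    then have "level (x j) i = 1"
      using x[OF j] by (intro level_eq_1) simp_all
    moreover have "i \<in> F j"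
      using i x[OF j] keys_concentrate[of "x j"] by (meson subsetD)
    ultimately show "i \<in> \<sigma> j" using level(2) by (meson DiffI)
  qed
qed

lemma weight_restrict:
  assumes "\<And>j. j \<in> J \<Longrightarrow> finite (F j) \<and> Poly_Mapping.keys (x j) \<subseteq> F j"
    and "\<And>j. j \<in> J \<Longrightarrow> \<sigma> j \<subseteq> Poly_Mapping.keys (x j)"
  shows "weight J F x \<sigma> = weight J (\<lambda>j. Poly_Mapping.keys (x j)) x \<sigma>"
  unfolding weight_def
proof (rule prod.cong[OF refl])
  fix j assume "j \<in> J"
  then have "(\<Prod>i\<in>F j - \<sigma> j. 1 - level (x j) i) = (\<Prod>i\<in>Poly_Mapping.keys (x j) - \<sigma> j. 1 - level (x j) i)"
    using assms(1)[of j] level_eq_0[of _ "x j"] by (intro prod.mono_neutral_right) auto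
  then show "(\<Prod>i\<in>\<sigma> j. level (x j) i) * (\<Prod>i\<in>F j - \<sigma> j. 1 - level (x j) i)
      = (\<Prod>i\<in>\<sigma> j. level (x j) i) * (\<Prod>i\<in>Poly_Mapping.keys (x j) - \<sigma> j. 1 - level (x j) i)"
    by simp
qed

text \<open>Vertices outside the carrier do not affect the expectation, so the sum may
  be taken over a range that is constant on a cell. This yields continuity.\<close>
lemma mean_vertex_eq:
  assumes J: "finite J" and F: "\<And>j. j \<in> J \<Longrightarrow> finite (F j)"
    and x: "\<And>j. j \<in> J \<Longrightarrow> simplex_point (x j) \<and> Poly_Mapping.keys (x j) \<subseteq> F j"
  shows "mean_vertex J w x = (\<Sum>\<sigma>\<in>(\<Pi>\<^sub>E j\<in>J. Pow (F j)). weight J F x \<sigma> *\<^sub>R basis_vec (w \<sigma>))"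
  unfolding mean_vertex_def
proof (rule sum.mono_neutral_cong_left)
  show "finite (\<Pi>\<^sub>E j\<in>J. Pow (F j))" using J F by (intro finite_PiE) auto
  show "(\<Pi>\<^sub>E j\<in>J. Pow (Poly_Mapping.keys (x j))) \<subseteq> (\<Pi>\<^sub>E j\<in>J. Pow (F j))"
    using x by (intro PiE_mono) auto
  show "\<forall>\<sigma>\<in>(\<Pi>\<^sub>E j\<in>J. Pow (F j)) - (\<Pi>\<^sub>E j\<in>J. Pow (Poly_Mapping.keys (x j))).
      weight J F x \<sigma> *\<^sub>R basis_vec (w \<sigma>) = 0"
  proof
    fix \<sigma> assume \<sigma>: "\<sigma> \<in> (\<Pi>\<^sub>E j\<in>J. Pow (F j)) - (\<Pi>\<^sub>E j\<in>J. Pow (Poly_Mapping.keys (x j)))"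
    then obtain j where "j \<in> J" "\<not> \<sigma> j \<subseteq> Poly_Mapping.keys (x j)"
      by (auto simp: PiE_iff)
    then have "weight J F x \<sigma> = 0"
      using weight_nonzero_sandwiched(2)[OF J F DiffD1[OF \<sigma>] x] by blast
    then show "weight J F x \<sigma> *\<^sub>R basis_vec (w \<sigma>) = 0" by simp
  qed
  fix \<sigma> assume "\<sigma> \<in> (\<Pi>\<^sub>E j\<in>J. Pow (Poly_Mapping.keys (x j)))"
  then have "weight J F x \<sigma> = weight J (\<lambda>j. Poly_Mapping.keys (x j)) x \<sigma>"
    using F x by (intro weight_restrict) (auto simp: PiE_iff)
  then show "weight J (\<lambda>j. Poly_Mapping.keys (x j)) x \<sigma> *\<^sub>R basis_vec (w \<sigma>)
      = weight J F x \<sigma> *\<^sub>R basis_vec (w \<sigma>)" by simp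
qed

definition sandwiched :: "nat set \<Rightarrow> (nat \<Rightarrow> 'a \<Rightarrow>\<^sub>0 real) \<Rightarrow> (nat \<Rightarrow> 'a set) set" where
  "sandwiched J x = {\<sigma> \<in> extensional J. \<forall>j\<in>J.
     Poly_Mapping.keys (concentrate (x j)) \<subseteq> \<sigma> j \<and> \<sigma> j \<subseteq> Poly_Mapping.keys (x j)}"

lemma sandwiched_subset_PiE: "sandwiched J x \<subseteq> (\<Pi>\<^sub>E j\<in>J. Pow (Poly_Mapping.keys (x j)))"
proof
  fix \<sigma> assume "\<sigma> \<in> sandwiched J x"
  then show "\<sigma> \<in> (\<Pi>\<^sub>E j\<in>J. Pow (Poly_Mapping.keys (x j)))"
    by (simp add: sandwiched_def PiE_iff)
qed

lemma finite_sandwiched: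
  assumes "finite J"
  shows "finite (sandwiched J x)"
proof (rule finite_subset)
  show "sandwiched J x \<subseteq> (\<Pi>\<^sub>E j\<in>J. Pow (Poly_Mapping.keys (x j)))"
    by (rule sandwiched_subset_PiE)
  show "finite (\<Pi>\<^sub>E j\<in>J. Pow (Poly_Mapping.keys (x j)))"
    using assms by (intro finite_PiE) auto
qed

lemma mean_vertex_in_simplex:
  assumes J: "finite J" and x: "\<And>j. j \<in> J \<Longrightarrow> simplex_point (x j)"
  shows "mean_vertex J w x \<in> geom_simplex (w ` sandwiched J x)"
proof -
  let ?A = "\<Pi>\<^sub>E j\<in>J. Pow (Poly_Mapping.keys (x j))"
  let ?W = "weight J (\<lambda>j. Poly_Mapping.keys (x j)) x"
  have fin: "finite ?A" using J by (intro finite_PiE) auto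
  have sub: "sandwiched J x \<subseteq> ?A" by (rule sandwiched_subset_PiE)
  have zero: "?W \<sigma> = 0" if \<sigma>: "\<sigma> \<in> ?A - sandwiched J x" for \<sigma>
  proof (rule ccontr)
    assume nz: "?W \<sigma> \<noteq> 0"
    have "Poly_Mapping.keys (concentrate (x j)) \<subseteq> \<sigma> j" "\<sigma> j \<subseteq> Poly_Mapping.keys (x j)" if "j \<in> J" for j
      using weight_nonzero_sandwiched[OF J _ DiffD1[OF \<sigma>] _ nz that] x by simp_all
    then have "\<sigma> \<in> sandwiched J x"
      using \<sigma> by (simp add: sandwiched_def PiE_iff)
    then show False using \<sigma> by blast
  qed
  have "mean_vertex J w x = (\<Sum>\<sigma>\<in>sandwiched J x. ?W \<sigma> *\<^sub>R basis_vec (w \<sigma>))"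
    unfolding mean_vertex_def using zero by (intro sum.mono_neutral_right[OF fin sub]) auto
  also have "\<dots> \<in> geom_simplex (w ` sandwiched J x)"
    unfolding geom_simplex_def
  proof (rule convex_sum[OF finite_sandwiched[OF J] convex_convex_hull])
    have "(\<Sum>\<sigma>\<in>sandwiched J x. ?W \<sigma>) = (\<Sum>\<sigma>\<in>?A. ?W \<sigma>)"
      using zero by (intro sum.mono_neutral_left[OF fin sub]) auto
    then show "(\<Sum>\<sigma>\<in>sandwiched J x. ?W \<sigma>) = 1"
      using sum_weight[OF J, of "\<lambda>j. Poly_Mapping.keys (x j)" x] by simp
    show "0 \<le> ?W \<sigma>" for \<sigma> by (rule weight_nonneg[OF x])
    show "basis_vec (w \<sigma>) \<in> convex hull basis_vec ` w ` sandwiched J x" if "\<sigma> \<in> sandwiched J x" for \<sigma>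
      using that by (intro hull_inc) auto
  qed
  finally show ?thesis .
qed

lemma continuous_map_mean_vertex:
  assumes J: "finite J" and F: "\<And>j. j \<in> J \<Longrightarrow> finite (F j)"
    and \<xi>: "\<And>z j. z \<in> topspace Z \<Longrightarrow> j \<in> J \<Longrightarrow> simplex_point (\<xi> z j) \<and> Poly_Mapping.keys (\<xi> z j) \<subseteq> F j"
    and coord: "\<And>j i. j \<in> J \<Longrightarrow> continuous_map Z euclideanreal (\<lambda>z. Poly_Mapping.lookup (\<xi> z j) i)"
  shows "continuous_map Z euclideanreal (\<lambda>z. Poly_Mapping.lookup (mean_vertex J w (\<xi> z)) i)"
proof (rule continuous_map_eq)
  have level: "continuous_map Z euclideanreal (\<lambda>z. level (\<xi> z j) i)" if "j \<in> J" for i j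
    using continuous_map_level[where \<xi> = "\<lambda>z. \<xi> z j", OF F[OF that] \<xi>[OF _ that] coord[OF that]] .
  have fin: "finite (\<Pi>\<^sub>E j\<in>J. Pow (F j))" using J F by (intro finite_PiE) auto
  have "continuous_map Z euclideanreal (\<lambda>z. weight J F (\<xi> z) \<sigma>)" if "\<sigma> \<in> (\<Pi>\<^sub>E j\<in>J. Pow (F j))" for \<sigma>
    unfolding weight_def
  proof (intro continuous_map_prod continuous_map_real_mult continuous_map_diff)
    fix j assume j: "j \<in> J"
    show "finite (\<sigma> j)" "finite (F j - \<sigma> j)"
      using F[OF j] PiE_mem[OF that j] finite_subset by auto
  qed (use J level in auto)
  then show "continuous_map Z euclideanreal
      (\<lambda>z. \<Sum>\<sigma>\<in>(\<Pi>\<^sub>E j\<in>J. Pow (F j)). weight J F (\<xi> z) \<sigma> * (if w \<sigma> = i then 1 else 0))"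
    using fin by (intro continuous_map_sum continuous_map_real_mult) auto
  show "(\<Sum>\<sigma>\<in>(\<Pi>\<^sub>E j\<in>J. Pow (F j)). weight J F (\<xi> z) \<sigma> * (if w \<sigma> = i then 1 else 0))
      = Poly_Mapping.lookup (mean_vertex J w (\<xi> z)) i" if "z \<in> topspace Z" for z
    by (simp only: mean_vertex_eq[OF J F \<xi>[OF that], where w = w] lookup_sum lookup_scaleR lookup_basis_vec)
qed

section \<open>Cylinders over cells and sliding to the concentrated point\<close>

lemma keys_subset_of_geom_simplex:
  "finite S \<Longrightarrow> x \<in> geom_simplex S \<Longrightarrow> Poly_Mapping.keys x \<subseteq> S"
  by (simp add: geom_simplex_eq)

lemma geom_simplex_mono: "S \<subseteq> S' \<Longrightarrow> geom_simplex S \<subseteq> geom_simplex S'"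
  unfolding geom_simplex_def by (intro hull_mono image_mono)

lemma segment_in_geom_simplex:
  assumes "x \<in> geom_simplex S" "y \<in> geom_simplex S" "0 \<le> t" "t \<le> 1"
  shows "(1 - t) *\<^sub>R x + t *\<^sub>R y \<in> geom_simplex S"
  using assms convexD_alt[OF convex_convex_hull] unfolding geom_simplex_def by blast

lemma simplex_point_of_cell:
  assumes "prod_complex J I P" "\<sigma> \<in> P" "x \<in> geom_cell J \<sigma>" "j \<in> J"
  shows "simplex_point (x j)" "Poly_Mapping.keys (x j) \<subseteq> \<sigma> j"
  using geom_cell_support(2)[OF prod_complex_cell(1)[OF assms(1,2)] assms(3,4)]
  by (simp_all add: simplex_point_def)

lemma realization_pointI:
  assumes "prod_complex J I P" "\<sigma> \<in> P" "z \<in> extensional J" "\<And>j. j \<in> J \<Longrightarrow> z j \<in> geom_simplex (\<sigma> j)"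
  shows "z \<in> topspace (realization J I P)"
proof -
  have "z \<in> geom_cell J \<sigma>"
    using assms(3,4) by (simp add: geom_cell_def PiE_iff)
  then show ?thesis
    unfolding topspace_realization[OF assms(1)] using assms(2) by (rule UN_I[rotated])
qed

abbreviation cylinder ::
  "'t topology \<Rightarrow> nat set \<Rightarrow> (nat \<Rightarrow> 'a set) \<Rightarrow> (nat \<Rightarrow> 'a set) \<Rightarrow> ('t \<times> (nat \<Rightarrow> 'a \<Rightarrow>\<^sub>0 real)) topology" where
  "cylinder T J I \<sigma> \<equiv>
     prod_topology T (subtopology (product_topology (\<lambda>j. real_space (I j)) J) (geom_cell J \<sigma>))"

lemma continuous_map_coordinate_cylinder:
  assumes "j \<in> J"
  shows "continuous_map (cylinder T J I \<sigma>) euclideanreal (\<lambda>z. Poly_Mapping.lookup (snd z j) i)"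
  using continuous_map_compose[OF continuous_map_snd continuous_map_barycentric_coordinate[OF assms]]
  unfolding o_def .

lemma continuous_map_concentrate_cylinder:
  assumes "prod_complex J I P" "\<sigma> \<in> P" "j \<in> J"
  shows "continuous_map (cylinder T J I \<sigma>) euclideanreal
           (\<lambda>z. Poly_Mapping.lookup (concentrate (snd z j)) i)"
proof (rule continuous_map_concentrate[where F = "\<sigma> j" and \<xi> = "\<lambda>z. snd z j"])
  show "simplex_point (snd z j) \<and> Poly_Mapping.keys (snd z j) \<subseteq> \<sigma> j"
    if "z \<in> topspace (cylinder T J I \<sigma>)" for z
    using simplex_point_of_cell[OF assms(1,2) _ assms(3), of "snd z"] that
    by (simp add: mem_Times_iff)
qed (simp_all add: prod_complex_cell(1)[OF assms] continuous_map_coordinate_cylinder[OF assms(3)])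

lemma continuous_map_mean_vertex_cylinder:
  assumes "prod_complex J I P" "\<sigma> \<in> P" "finite J" "J' \<subseteq> J"
  shows "continuous_map (cylinder T J I \<sigma>) euclideanreal
           (\<lambda>z. Poly_Mapping.lookup (mean_vertex J' w (snd z)) i)"
proof (rule continuous_map_mean_vertex[where F = \<sigma> and \<xi> = snd])
  show "simplex_point (snd z j) \<and> Poly_Mapping.keys (snd z j) \<subseteq> \<sigma> j"
    if "z \<in> topspace (cylinder T J I \<sigma>)" "j \<in> J'" for z j
    using simplex_point_of_cell[OF assms(1,2) _ subsetD[OF assms(4) that(2)], of "snd z"] that(1)
    by (simp add: mem_Times_iff)
  show "finite J'" using assms(3,4) by (rule finite_subset[rotated])
  show "finite (\<sigma> j)" if "j \<in> J'" for j
    using subsetD[OF assms(4) that] by (rule prod_complex_cell(1)[OF assms(1,2)])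
  show "continuous_map (cylinder T J I \<sigma>) euclideanreal (\<lambda>z. Poly_Mapping.lookup (snd z j) i)"
    if "j \<in> J'" for j i
    using subsetD[OF assms(4) that] by (rule continuous_map_coordinate_cylinder)
qed

lemma continuous_map_time_cylinder:
  "continuous_map (cylinder (top_of_set S) J I \<sigma>) euclideanreal fst"
  by (rule continuous_map_into_fulltopology[OF continuous_map_fst])

definition slide :: "nat set \<Rightarrow> nat set \<Rightarrow> real \<Rightarrow> (nat \<Rightarrow> 'a \<Rightarrow>\<^sub>0 real) \<Rightarrow> (nat \<Rightarrow> 'a \<Rightarrow>\<^sub>0 real)" where
  "slide J K t x = (\<lambda>j\<in>J. if j \<in> K then (1 - t) *\<^sub>R x j + t *\<^sub>R concentrate (x j) else x j)"

lemma concentrate_in_geom_simplex: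
  assumes "simplex_point x" "Poly_Mapping.keys x \<subseteq> S"
  shows "concentrate x \<in> geom_simplex S"
  using concentrate_simplex[OF assms(1)] keys_concentrate[of x] assms(2) geom_simplex_mono
  unfolding simplex_point_def by (meson order_trans subsetD)

text \<open>Concentration only shrinks carriers, so the segment from a point to its concentration stays in
  every cell that contains the point.\<close>
lemma homotopic_with_slide:
  assumes P: "prod_complex J I P" and J: "finite J"
  shows "homotopic_with (\<lambda>x. True) (realization J I P) (realization J I P) id (slide J K 1)"
proof -
  let ?T = "top_of_set {0..1::real}" and ?h = "\<lambda>z. slide J K (fst z) (snd z)"
  have slide_simplex: "slide J K t x j \<in> geom_simplex (\<sigma> j)"
    if "\<sigma> \<in> P" "t \<in> topspace ?T" "x \<in> geom_cell J \<sigma>" "j \<in> J" for \<sigma> t x j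
  proof -
    have "x j \<in> geom_simplex (\<sigma> j)"
      using that(3,4) by (simp add: geom_cell_def PiE_iff)
    moreover have "concentrate (x j) \<in> geom_simplex (\<sigma> j)"
      using concentrate_in_geom_simplex simplex_point_of_cell[OF P that(1,3,4)] .
    ultimately show ?thesis
      using that(2,4) by (simp add: slide_def segment_in_geom_simplex)
  qed
  have "continuous_map (prod_topology ?T (realization J I P)) (realization J I P) ?h"
  proof (rule continuous_map_prod_realization[OF _ _ P P J, where F = "\<lambda>\<sigma>. \<sigma>"])
    show "locally_compact_space ?T"
      by (simp add: compact_imp_locally_compact_space compact_space_subtopology)
    show "Hausdorff_space ?T"
      by (simp add: Hausdorff_space_subtopology)
    fix \<sigma> assume \<sigma>: "\<sigma> \<in> P"
    show "finite (\<sigma> j)" if "j \<in> J" for j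
      using prod_complex_cell(1)[OF P \<sigma> that] .
    show "?h (t, x) \<in> topspace (realization J I P)" if "t \<in> topspace ?T" "x \<in> geom_cell J \<sigma>" for t x
      unfolding fst_conv snd_conv
    proof (rule realization_pointI[OF P \<sigma>])
      show "slide J K t x \<in> extensional J" by (simp add: slide_def)
    qed (rule slide_simplex[OF \<sigma> that])
    show "Poly_Mapping.keys (?h (t, x) j) \<subseteq> \<sigma> j"
      if "t \<in> topspace ?T" "x \<in> geom_cell J \<sigma>" "j \<in> J" for t x j
      unfolding fst_conv snd_conv
      using keys_subset_of_geom_simplex[OF prod_complex_cell(1)[OF P \<sigma> that(3)] slide_simplex[OF \<sigma> that]] .
    show "continuous_map (cylinder ?T J I \<sigma>) euclideanreal (\<lambda>z. Poly_Mapping.lookup (?h z j) i)"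
      if "j \<in> J" for j i
    proof (cases "j \<in> K")
      case True
      have "continuous_map (cylinder ?T J I \<sigma>) euclideanreal (\<lambda>z.
          (1 - fst z) * Poly_Mapping.lookup (snd z j) i + fst z * Poly_Mapping.lookup (concentrate (snd z j)) i)"
        by (intro continuous_map_add continuous_map_real_mult continuous_map_diff
            continuous_map_time_cylinder continuous_map_coordinate_cylinder[OF that]
            continuous_map_concentrate_cylinder[OF P \<sigma> that]) simp
      then show ?thesis using that True by (simp add: slide_def lookup_add)
    next
      case False
      then show ?thesis
        using continuous_map_coordinate_cylinder[OF that] that by (simp add: slide_def)
    qed
  qed
  moreover have "?h (0, x) = id x" if "x \<in> topspace (realization J I P)" for x
  proof -
    have "x \<in> extensional J"
      using support_realization(2)[OF P that] by (simp add: geom_cell_def PiE_iff)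
    then show ?thesis by (auto simp: slide_def extensional_def fun_eq_iff)
  qed
  ultimately show ?thesis
    by (subst homotopic_with) (simp, rule exI[of _ ?h], simp)
qed

section \<open>Quotient by a full direction\<close>

text \<open>At time \<open>1\<close> the value depends on the factors other than the \<open>k\<close>-th alone and is the homotopy inverse of
  the projection. At time \<open>0\<close> it is the end of the slide of all factors other than the \<open>k\<close>-th.\<close>
definition straighten ::
  "nat set \<Rightarrow> nat \<Rightarrow> ((nat \<Rightarrow> 'a set) \<Rightarrow> 'a) \<Rightarrow> real \<Rightarrow> (nat \<Rightarrow> 'a \<Rightarrow>\<^sub>0 real) \<Rightarrow> (nat \<Rightarrow> 'a \<Rightarrow>\<^sub>0 real)" where
  "straighten J k w t x = (\<lambda>j\<in>J. if j = k then (1 - t) *\<^sub>R x k + t *\<^sub>R mean_vertex (J - {k}) w x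
     else concentrate (x j))"

lemma mean_vertex_cong:
  assumes "\<And>j. j \<in> J \<Longrightarrow> x j = y j"
  shows "mean_vertex J w x = mean_vertex J w y"
proof -
  have "weight J (\<lambda>j. Poly_Mapping.keys (x j)) x = weight J (\<lambda>j. Poly_Mapping.keys (y j)) y"
    unfolding weight_def using assms by (intro ext prod.cong refl) simp
  moreover have "(\<Pi>\<^sub>E j\<in>J. Pow (Poly_Mapping.keys (x j))) = (\<Pi>\<^sub>E j\<in>J. Pow (Poly_Mapping.keys (y j)))"
    using assms by (intro PiE_cong) simp
  ultimately show ?thesis unfolding mean_vertex_def by simp
qed

lemma straighten_omit_factor:
  "straighten J k w 1 (omit_factor J k x) = straighten J k w 1 x"
proof -
  have "mean_vertex (J - {k}) w (omit_factor J k x) = mean_vertex (J - {k}) w x"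
    by (rule mean_vertex_cong) (simp add: omit_factor_def)
  then show ?thesis by (auto simp: straighten_def omit_factor_def fun_eq_iff)
qed

text \<open>Fullness: a cell belongs to the complex as soon as all its slices with a single vertex
  in direction \<open>k\<close> do.\<close>
locale full_direction =
  fixes J :: "nat set" and I :: "nat \<Rightarrow> 'a set" and P :: "(nat \<Rightarrow> 'a set) set" and k :: nat
  assumes P: "prod_complex J I P" and J: "finite J" and k: "k \<in> J"
    and full: "\<And>\<sigma>. \<lbrakk>\<sigma> \<in> extensional J; finite (\<sigma> k); \<sigma> k \<noteq> {}; \<And>i. i \<in> \<sigma> k \<Longrightarrow> \<sigma>(k := {i}) \<in> P\<rbrakk> \<Longrightarrow> \<sigma> \<in> P"
begin

abbreviation Q :: "(nat \<Rightarrow> 'a set) set" where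
  "Q \<equiv> dowkerian_quotient J k P"

lemma Q: "prod_complex (J - {k}) I Q"
  by (rule prod_complex_dowkerian_quotient[OF P k])

text \<open>An arbitrary vertex if \<^term>\<open>\<tau>\<close> is not in \<^term>\<open>Q\<close>; such tuples, among them those with an empty
  factor, receive weight \<open>0\<close> in \<^const>\<open>mean_vertex\<close> over a point of the realization of \<^term>\<open>Q\<close>.\<close>
definition apex :: "(nat \<Rightarrow> 'a set) \<Rightarrow> 'a" where
  "apex \<tau> = (SOME i. \<tau>(k := {i}) \<in> P)"

lemma apex: "\<tau> \<in> Q \<Longrightarrow> \<tau>(k := {apex \<tau>}) \<in> P"
proof -
  assume "\<tau> \<in> Q"
  then obtain \<rho> where \<rho>: "\<rho> \<in> P" "\<tau> = omit_factor J k \<rho>"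
    by (auto simp: dowkerian_quotient_def)
  obtain i where i: "i \<in> \<rho> k"
    using prod_complex_cell(2)[OF P \<rho>(1) k] by blast
  have "\<tau>(k := {i}) \<in> P"
  proof (rule prod_complex_face[OF P \<rho>(1)])
    show "\<tau>(k := {i}) \<in> extensional J"
      using k by (auto simp: \<rho>(2) omit_factor_def extensional_def)
    show "(\<tau>(k := {i})) j \<noteq> {} \<and> (\<tau>(k := {i})) j \<subseteq> \<rho> j" if "j \<in> J" for j
      using i that prod_complex_cell(2)[OF P \<rho>(1) that] by (simp add: \<rho>(2) omit_factor_def)
  qed
  then show ?thesis unfolding apex_def by (rule someI)
qed

definition core :: "(nat \<Rightarrow> 'a \<Rightarrow>\<^sub>0 real) \<Rightarrow> (nat \<Rightarrow> 'a set)" where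
  "core x = (\<lambda>j\<in>J - {k}. Poly_Mapping.keys (concentrate (x j)))"

text \<open>The order reversal at work: \<^term>\<open>apex \<sigma>\<close> is compatible with \<^term>\<open>\<sigma>\<close>, hence with the core, which
  is a face of every sandwiched \<^term>\<open>\<sigma>\<close>.\<close>
lemma core_join_apex:
  assumes x: "\<And>j. j \<in> J - {k} \<Longrightarrow> simplex_point (x j)" "support (J - {k}) x \<in> Q"
    and i: "i \<in> apex ` sandwiched (J - {k}) x"
  shows "(core x)(k := {i}) \<in> P"
proof -
  obtain \<sigma> where \<sigma>: "\<sigma> \<in> sandwiched (J - {k}) x" "i = apex \<sigma>" using i by blast
  have ne: "Poly_Mapping.keys (concentrate (x j)) \<noteq> {}" if "j \<in> J - {k}" for j
    using simplex_pointD(3)[OF concentrate_simplex[OF x(1)[OF that]]] .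
  have btw: "Poly_Mapping.keys (concentrate (x j)) \<subseteq> \<sigma> j" "\<sigma> j \<subseteq> Poly_Mapping.keys (x j)"
    if "j \<in> J - {k}" for j
    using \<sigma>(1) that unfolding sandwiched_def by simp_all
  have "\<sigma> \<in> Q"
  proof (rule prod_complex_face[OF Q x(2)])
    show "\<sigma> \<in> extensional (J - {k})" using \<sigma>(1) by (simp add: sandwiched_def)
    show "\<sigma> j \<noteq> {} \<and> \<sigma> j \<subseteq> support (J - {k}) x j" if "j \<in> J - {k}" for j
      using ne[OF that] btw[OF that] that by (auto simp: support_def)
  qed
  then have "\<sigma>(k := {i}) \<in> P" unfolding \<sigma>(2) by (rule apex)
  then show ?thesis
  proof (rule prod_complex_face[OF P])
    show "(core x)(k := {i}) \<in> extensional J"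
      using k by (auto simp: core_def extensional_def)
    show "((core x)(k := {i})) j \<noteq> {} \<and> ((core x)(k := {i})) j \<subseteq> (\<sigma>(k := {i})) j" if "j \<in> J" for j
      using ne[of j] btw(1)[of j] that by (simp add: core_def)
  qed
qed

lemma core_join_vertex:
  assumes y: "y \<in> topspace (realization J I P)" and i: "i \<in> Poly_Mapping.keys (y k)"
  shows "(core y)(k := {i}) \<in> P"
proof (rule prod_complex_face[OF P support_realization(1)[OF P y]])
  note point = simplex_point_of_cell[OF P support_realization[OF P y]]
  show "(core y)(k := {i}) \<in> extensional J"
    using k by (auto simp: core_def extensional_def)
  show "((core y)(k := {i})) j \<noteq> {} \<and> ((core y)(k := {i})) j \<subseteq> support J y j" if "j \<in> J" for j
    using that i simplex_pointD(3)[OF concentrate_simplex[OF point(1)[OF that]]] keys_concentrate[of "y j"]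
    by (simp add: core_def support_def)
qed

lemma core_join:
  assumes "finite S" "S \<noteq> {}" "\<And>i. i \<in> S \<Longrightarrow> (core x)(k := {i}) \<in> P"
  shows "(core x)(k := S) \<in> P"
proof (rule full)
  show "(core x)(k := S) \<in> extensional J"
    using k by (auto simp: core_def extensional_def)
qed (use assms in simp_all)

lemma straighten_in_realization:
  assumes x: "\<And>j. j \<in> J - {k} \<Longrightarrow> simplex_point (x j)"
    and S: "finite S" "S \<noteq> {}" "\<And>i. i \<in> S \<Longrightarrow> (core x)(k := {i}) \<in> P"
    and last: "straighten J k w t x k \<in> geom_simplex S"
  shows "straighten J k w t x \<in> topspace (realization J I P)"
proof (rule realization_pointI[OF P core_join[OF S]])
  show "straighten J k w t x \<in> extensional J" by (simp add: straighten_def)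
  show "straighten J k w t x j \<in> geom_simplex (((core x)(k := S)) j)" if "j \<in> J" for j
    using last x[of j] concentrate_simplex[of "x j"] that
    by (cases "j = k") (simp_all add: straighten_def core_def simplex_point_def)
qed

lemma support_omit:
  assumes "support J y \<in> P"
  shows "support (J - {k}) y \<in> Q"
proof -
  have "support (J - {k}) y = omit_factor J k (support J y)"
    by (auto simp: support_def omit_factor_def fun_eq_iff)
  then show ?thesis using assms unfolding dowkerian_quotient_def by blast
qed

text \<open>Along the straightening the \<open>k\<close>-th factor runs in the simplex spanned by the old vertices and
  the apices. All of them are compatible with the core, so fullness applies to their union.\<close>
lemma straighten_mem:
  assumes y: "y \<in> topspace (realization J I P)" and t: "0 \<le> t" "t \<le> 1"
  shows "straighten J k apex t y \<in> topspace (realization J I P)"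
proof -
  note point = simplex_point_of_cell[OF P support_realization[OF P y]]
  let ?B = "apex ` sandwiched (J - {k}) y"
  let ?S = "Poly_Mapping.keys (y k) \<union> ?B"
  have pt: "simplex_point (y j)" if "j \<in> J - {k}" for j using point(1) that by simp
  have fin: "finite (J - {k})" using J by simp
  have yk: "y k \<in> geom_simplex (Poly_Mapping.keys (y k))" 
    using point(1)[OF k] unfolding simplex_point_def .
  have mv: "mean_vertex (J - {k}) apex y \<in> geom_simplex ?B"
    by (rule mean_vertex_in_simplex[OF fin pt])
  have "(1 - t) *\<^sub>R y k + t *\<^sub>R mean_vertex (J - {k}) apex y \<in> geom_simplex ?S"
    using subsetD[OF geom_simplex_mono yk, of ?S] subsetD[OF geom_simplex_mono mv, of ?S] t
    by (intro segment_in_geom_simplex) simp_all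
  then have "straighten J k apex t y k \<in> geom_simplex ?S"
    using k by (simp add: straighten_def)
  then show ?thesis
  proof (rule straighten_in_realization[rotated 4])
    show "finite ?S" using finite_sandwiched[OF fin, of y] by simp
    show "?S \<noteq> {}" using simplex_pointD(3)[OF point(1)[OF k]] by simp
    show "(core y)(k := {i}) \<in> P" if "i \<in> ?S" for i
      using that core_join_vertex[OF y] core_join_apex[OF pt support_omit[OF support_realization(1)[OF P y]]]
      by (meson UnE)
  qed (rule pt)
qed

lemma lift_mem:
  assumes x: "x \<in> topspace (realization (J - {k}) I Q)"
  shows "straighten J k apex 1 x \<in> topspace (realization J I P)"
proof (rule straighten_in_realization)
  let ?B = "apex ` sandwiched (J - {k}) x"
  note supp = support_realization[OF Q x]
  have fin: "finite (J - {k})" using J by simp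
  show pt: "simplex_point (x j)" if "j \<in> J - {k}" for j
    using simplex_point_of_cell(1)[OF Q supp that] .
  show "finite ?B" using finite_sandwiched[OF fin, of x] by simp
  have mv: "mean_vertex (J - {k}) apex x \<in> geom_simplex ?B"
    by (rule mean_vertex_in_simplex[OF fin pt])
  then show "straighten J k apex 1 x k \<in> geom_simplex ?B"
    using k by (simp add: straighten_def)
  show "?B \<noteq> {}" using mv by (auto simp: geom_simplex_def)
  show "(core x)(k := {i}) \<in> P" if "i \<in> ?B" for i
    by (rule core_join_apex[OF pt supp(1) that])
qed

text \<open>All vertices that can occur in \<^const>\<open>mean_vertex\<close> over the cell \<^term>\<open>\<sigma>\<close>.\<close>
definition carrier_bound :: "(nat \<Rightarrow> 'a set) \<Rightarrow> 'a set" where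
  "carrier_bound \<sigma> = apex ` (\<Pi>\<^sub>E j\<in>J - {k}. Pow (\<sigma> j))"

lemma finite_carrier_bound:
  assumes "\<And>j. j \<in> J - {k} \<Longrightarrow> finite (\<sigma> j)"
  shows "finite (carrier_bound \<sigma>)"
  unfolding carrier_bound_def using assms J by (intro finite_imageI finite_PiE) simp_all

lemma keys_mean_vertex:
  assumes "\<And>j. j \<in> J - {k} \<Longrightarrow> simplex_point (x j)" "\<And>j. j \<in> J - {k} \<Longrightarrow> Poly_Mapping.keys (x j) \<subseteq> \<sigma> j"
  shows "Poly_Mapping.keys (mean_vertex (J - {k}) apex x) \<subseteq> carrier_bound \<sigma>"
proof -
  have fin: "finite (J - {k})" using J by simp
  have "Poly_Mapping.keys (mean_vertex (J - {k}) apex x) \<subseteq> apex ` sandwiched (J - {k}) x"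
    using finite_sandwiched[OF fin, of x]
    by (intro keys_subset_of_geom_simplex mean_vertex_in_simplex[OF fin assms(1)]) simp_all
  also have "\<dots> \<subseteq> carrier_bound \<sigma>"
    unfolding carrier_bound_def
    by (intro image_mono order_trans[OF sandwiched_subset_PiE] PiE_mono Pow_mono assms(2))
  finally show ?thesis .
qed

lemma continuous_map_quotient:
  "continuous_map (realization J I P) (realization (J - {k}) I Q) (geom_quotient_map J k)"
proof (rule continuous_map_realization[OF P Q, where F = "\<lambda>\<sigma>. \<sigma>"])
  show "finite (J - {k})" using J by simp
  fix \<sigma> assume \<sigma>: "\<sigma> \<in> P"
  show "finite (\<sigma> j)" if "j \<in> J - {k}" for j
    using prod_complex_cell(1)[OF P \<sigma>] that by simp
  have "omit_factor J k \<sigma> \<in> Q" using \<sigma> unfolding dowkerian_quotient_def by (rule imageI)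
  then show "geom_quotient_map J k x \<in> topspace (realization (J - {k}) I Q)" if "x \<in> geom_cell J \<sigma>" for x
    by (rule realization_pointI[OF Q])
       (use that in \<open>simp_all add: geom_quotient_map_def omit_factor_def geom_cell_def PiE_iff\<close>)
  show "Poly_Mapping.keys (geom_quotient_map J k x j) \<subseteq> \<sigma> j" if "x \<in> geom_cell J \<sigma>" "j \<in> J - {k}" for x j
    using simplex_point_of_cell(2)[OF P \<sigma> that(1)] that(2)
    by (simp add: geom_quotient_map_def omit_factor_def)
  show "continuous_map (subtopology (product_topology (\<lambda>j. real_space (I j)) J) (geom_cell J \<sigma>))
      euclideanreal (\<lambda>x. Poly_Mapping.lookup (geom_quotient_map J k x j) i)" if "j \<in> J - {k}" for j i
    using continuous_map_barycentric_coordinate[of j J I "geom_cell J \<sigma>" i] that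
    by (simp add: geom_quotient_map_def omit_factor_def)
qed

lemma continuous_map_lift:
  "continuous_map (realization (J - {k}) I Q) (realization J I P) (straighten J k apex 1)"
proof (rule continuous_map_realization[OF Q P J, where F = "\<lambda>\<sigma> j. if j = k then carrier_bound \<sigma> else \<sigma> j"])
  fix \<sigma> assume \<sigma>: "\<sigma> \<in> Q"
  note fin = prod_complex_cell(1)[OF Q \<sigma>]
  show "finite (if j = k then carrier_bound \<sigma> else \<sigma> j)" if "j \<in> J" for j
    using finite_carrier_bound[OF fin] fin[of j] that by simp
  show "straighten J k apex 1 x \<in> topspace (realization J I P)" if "x \<in> geom_cell (J - {k}) \<sigma>" for x
    using that \<sigma> unfolding topspace_realization[OF Q, symmetric]
    by (intro lift_mem) (simp only: topspace_realization[OF Q], rule UN_I)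
  show "Poly_Mapping.keys (straighten J k apex 1 x j) \<subseteq> (if j = k then carrier_bound \<sigma> else \<sigma> j)"
    if x: "x \<in> geom_cell (J - {k}) \<sigma>" and j: "j \<in> J" for x j
  proof (cases "j = k")
    case True
    then show ?thesis
      using keys_mean_vertex[of x \<sigma>] simplex_point_of_cell[OF Q \<sigma> x] j by (simp add: straighten_def)
  next
    case False
    then show ?thesis
      using order_trans[OF keys_concentrate simplex_point_of_cell(2)[OF Q \<sigma> x, of j]] j
      by (simp add: straighten_def)
  qed
  let ?X = "subtopology (product_topology (\<lambda>j. real_space (I j)) (J - {k})) (geom_cell (J - {k}) \<sigma>)"
  show "continuous_map ?X euclideanreal (\<lambda>x. Poly_Mapping.lookup (straighten J k apex 1 x j) i)"
    if j: "j \<in> J" for j i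
  proof -
    let ?T = "discrete_topology {()}"
    have into: "continuous_map ?X (cylinder ?T (J - {k}) I \<sigma>) (\<lambda>x. ((), x))"
      by (simp add: continuous_map_pairwise o_def)
    have "continuous_map (cylinder ?T (J - {k}) I \<sigma>) euclideanreal
        (\<lambda>z. Poly_Mapping.lookup (straighten J k apex 1 (snd z) j) i)"
    proof (cases "j = k")
      case True
      then show ?thesis
        using continuous_map_mean_vertex_cylinder[OF Q \<sigma> _ order_refl] J k by (simp add: straighten_def)
    next
      case False
      then show ?thesis
        using continuous_map_concentrate_cylinder[OF Q \<sigma>, of j] j by (simp add: straighten_def)
    qed
    from continuous_map_compose[OF into this] show ?thesis by (simp add: o_def)
  qed
qed

lemma homotopic_straighten:
  "homotopic_with (\<lambda>x. True) (realization J I P) (realization J I P)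
     (straighten J k apex 0) (straighten J k apex 1)"
proof -
  let ?T = "top_of_set {0..1::real}" and ?h = "\<lambda>z. straighten J k apex (fst z) (snd z)"
  have "continuous_map (prod_topology ?T (realization J I P)) (realization J I P) ?h"
  proof (rule continuous_map_prod_realization[OF _ _ P P J,
        where F = "\<lambda>\<sigma> j. if j = k then \<sigma> k \<union> carrier_bound \<sigma> else \<sigma> j"])
    show "locally_compact_space ?T"
      by (simp add: compact_imp_locally_compact_space compact_space_subtopology)
    show "Hausdorff_space ?T"
      by (simp add: Hausdorff_space_subtopology)
    fix \<sigma> assume \<sigma>: "\<sigma> \<in> P"
    note fin = prod_complex_cell(1)[OF P \<sigma>]
    show "finite (if j = k then \<sigma> k \<union> carrier_bound \<sigma> else \<sigma> j)" if "j \<in> J" for j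
      using finite_carrier_bound[of \<sigma>] fin that k by simp
    show "?h (t, x) \<in> topspace (realization J I P)" if "t \<in> topspace ?T" "x \<in> geom_cell J \<sigma>" for t x
    proof -
      have "x \<in> topspace (realization J I P)"
        unfolding topspace_realization[OF P] using \<sigma> that(2) by blast
      then show ?thesis using straighten_mem that(1) by simp
    qed
    show "Poly_Mapping.keys (?h (t, x) j) \<subseteq> (if j = k then \<sigma> k \<union> carrier_bound \<sigma> else \<sigma> j)"
      if "t \<in> topspace ?T" and x: "x \<in> geom_cell J \<sigma>" and j: "j \<in> J" for t x j
    proof (cases "j = k")
      case True
      have "Poly_Mapping.keys (x k) \<subseteq> \<sigma> k" "Poly_Mapping.keys (mean_vertex (J - {k}) apex x) \<subseteq> carrier_bound \<sigma>"
        using keys_mean_vertex[of x \<sigma>] simplex_point_of_cell[OF P \<sigma> x] k by simp_all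
      then have "Poly_Mapping.lookup (x k) i = 0 \<and> Poly_Mapping.lookup (mean_vertex (J - {k}) apex x) i = 0"
        if "i \<notin> \<sigma> k \<union> carrier_bound \<sigma>" for i
        using that by (metis UnI1 UnI2 in_keys_iff subsetD)
      then have "Poly_Mapping.lookup (?h (t, x) k) i = 0" if "i \<notin> \<sigma> k \<union> carrier_bound \<sigma>" for i
        using that k by (simp add: straighten_def lookup_add)
      then show ?thesis using True by (auto simp: in_keys_iff)
    next
      case False
      then show ?thesis
        using simplex_point_of_cell(2)[OF P \<sigma> x j] keys_concentrate[of "x j"] j
        by (simp add: straighten_def)
    qed
    show "continuous_map (cylinder ?T J I \<sigma>) euclideanreal (\<lambda>z. Poly_Mapping.lookup (?h z j) i)"
      if j: "j \<in> J" for j i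
    proof (cases "j = k")
      case True
      have "continuous_map (cylinder ?T J I \<sigma>) euclideanreal (\<lambda>z.
          (1 - fst z) * Poly_Mapping.lookup (snd z k) i
          + fst z * Poly_Mapping.lookup (mean_vertex (J - {k}) apex (snd z)) i)"
        by (intro continuous_map_add continuous_map_real_mult continuous_map_diff
            continuous_map_time_cylinder continuous_map_coordinate_cylinder[OF k]
            continuous_map_mean_vertex_cylinder[OF P \<sigma> J]) auto
      then show ?thesis using k True by (simp add: straighten_def lookup_add)
    next
      case False
      then show ?thesis
        using continuous_map_concentrate_cylinder[OF P \<sigma> j] j by (simp add: straighten_def)
    qed
  qed
  then show ?thesis
    by (subst homotopic_with) (simp, rule exI[of _ ?h], simp)
qed

text \<open>Concatenating the slide of the base point with the straightening of the \<open>k\<close>-th factor contracts the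
  composite on \<open>|P|\<close>; on \<open>|Q|\<close> the slide alone suffices.\<close>
theorem homotopy_equivalence_quotient:
  "homotopy_equivalence_map (realization J I P) (realization (J - {k}) I Q) (geom_quotient_map J k)"
  unfolding homotopy_equivalence_map_def
proof (intro conjI exI[of _ "straighten J k apex 1"])
  let ?X = "realization J I P" and ?Y = "realization (J - {k}) I Q"
  have "straighten J k apex 1 \<circ> geom_quotient_map J k = straighten J k apex 1"
    by (simp add: geom_quotient_map_def straighten_omit_factor o_def)
  moreover have "straighten J k apex 0 = slide J (J - {k}) 1"
    by (auto simp: straighten_def slide_def fun_eq_iff)
  ultimately have "homotopic_with (\<lambda>x. True) ?X ?X (slide J (J - {k}) 1) (straighten J k apex 1 \<circ> geom_quotient_map J k)"
    using homotopic_straighten by simp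
  from homotopic_with_trans[OF homotopic_with_slide[OF P J] this]
  show "homotopic_with (\<lambda>x. True) ?X ?X (straighten J k apex 1 \<circ> geom_quotient_map J k) id"
    by (rule homotopic_with_symD)
  have "geom_quotient_map J k \<circ> straighten J k apex 1 = slide (J - {k}) (J - {k}) 1"
    by (auto simp: geom_quotient_map_def omit_factor_def straighten_def slide_def fun_eq_iff)
  then show "homotopic_with (\<lambda>x. True) ?Y ?Y (geom_quotient_map J k \<circ> straighten J k apex 1) id"
    using homotopic_with_slide[OF Q, of "J - {k}"] J by (simp add: homotopic_with_symD)
qed (rule continuous_map_quotient continuous_map_lift)+

lemma quotient_image:
  "geom_quotient_map J k ` topspace (realization J I P) = topspace (realization (J - {k}) I Q)"
proof
  show "geom_quotient_map J k ` topspace (realization J I P) \<subseteq> topspace (realization (J - {k}) I Q)"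
    by (rule continuous_map_image_subset_topspace[OF continuous_map_quotient])
  show "topspace (realization (J - {k}) I Q) \<subseteq> geom_quotient_map J k ` topspace (realization J I P)"
  proof
    fix x assume x: "x \<in> topspace (realization (J - {k}) I Q)"
    let ?\<tau> = "support (J - {k}) x"
    note supp = support_realization[OF Q x]
    have x_cell: "x \<in> extensional (J - {k})" "\<And>j. j \<in> J - {k} \<Longrightarrow> x j \<in> geom_simplex (?\<tau> j)"
      using supp(2) by (simp_all add: geom_cell_def PiE_iff)
    have "x(k := basis_vec (apex ?\<tau>)) \<in> topspace (realization J I P)"
    proof (rule realization_pointI[OF P apex[OF supp(1)]])
      show "x(k := basis_vec (apex ?\<tau>)) \<in> extensional J"
        using x_cell(1) k by (auto simp: extensional_def)
      show "(x(k := basis_vec (apex ?\<tau>))) j \<in> geom_simplex ((?\<tau>(k := {apex ?\<tau>})) j)" if "j \<in> J" for j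
        using x_cell(2)[of j] that by (simp add: geom_simplex_def)
    qed
    moreover have "geom_quotient_map J k (x(k := basis_vec (apex ?\<tau>))) = x"
      using x_cell(1) by (auto simp: geom_quotient_map_def omit_factor_def extensional_def fun_eq_iff)
    ultimately show "x \<in> geom_quotient_map J k ` topspace (realization J I P)"
      by (metis image_eqI)
  qed
qed

end

section \<open>Dowker products\<close>

text \<open>Every tuple of \<open>\<Prod> \<sigma> j\<close> already lies in the slice given by its own \<open>k\<close>-th entry.\<close>
lemma dowker_product_full:
  assumes k: "k \<in> J"
    and \<sigma>: "\<sigma> \<in> extensional J" "finite (\<sigma> k)" "\<sigma> k \<noteq> {}" "\<And>i. i \<in> \<sigma> k \<Longrightarrow> \<sigma>(k := {i}) \<in> dowker_product J I R"
  shows "\<sigma> \<in> dowker_product J I R"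
proof -
  have sub: "(\<Pi>\<^sub>E j\<in>J. (\<sigma>(k := {i})) j) \<subseteq> R" and delta: "\<And>j. j \<in> J \<Longrightarrow> (\<sigma>(k := {i})) j \<in> Delta (I j)"
    if "i \<in> \<sigma> k" for i
    using \<sigma>(4)[OF that] unfolding dowker_product_def by (blast, blast dest: PiE_mem)
  have "\<sigma> j \<in> Delta (I j)" if "j \<in> J" for j
  proof (cases "j = k")
    case True
    have "i \<in> I k" if "i \<in> \<sigma> k" for i
      using delta[OF that k] by (simp add: Delta_def Fpow_def)
    then show ?thesis using \<sigma>(2,3) True by (auto simp: Delta_def Fpow_def)
  next
    case False
    obtain i where "i \<in> \<sigma> k" using \<sigma>(3) by blast
    from delta[OF this that] False show ?thesis by simp
  qed
  moreover have "f \<in> R" if f: "f \<in> (\<Pi>\<^sub>E j\<in>J. \<sigma> j)" for f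
  proof -
    have "f k \<in> \<sigma> k" using f k by (rule PiE_mem)
    moreover have "f \<in> (\<Pi>\<^sub>E j\<in>J. (\<sigma>(k := {f k})) j)"
      using f by (simp add: PiE_iff)
    ultimately show ?thesis using subsetD[OF sub] by blast
  qed
  ultimately show ?thesis
    using \<sigma>(1) by (simp add: dowker_product_def PiE_iff subset_iff)
qed

theorem theorem4p3p2:
  fixes m :: nat and I :: "nat \<Rightarrow> 'a set" and R :: "(nat \<Rightarrow> 'a) set"
  assumes "R \<subseteq> (\<Pi>\<^sub>E j\<in>{1..m}. I j)"
  shows "\<forall>k\<in>{1..m}.
    geom_quotient_map {1..m} k `
        topspace (realization {1..m} I (dowker_product {1..m} I R))
      = topspace (realization ({1..m} - {k}) I
          (dowkerian_quotient {1..m} k (dowker_product {1..m} I R))) \<and>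
    homotopy_equivalence_map
      (realization {1..m} I (dowker_product {1..m} I R))
      (realization ({1..m} - {k}) I
        (dowkerian_quotient {1..m} k (dowker_product {1..m} I R)))
      (geom_quotient_map {1..m} k)"
proof
  fix k assume k: "k \<in> {1..m}"
  interpret full_direction "{1..m}" I "dowker_product {1..m} I R" k
  proof
    show "\<sigma> \<in> dowker_product {1..m} I R"
      if "\<sigma> \<in> extensional {1..m}" "finite (\<sigma> k)" "\<sigma> k \<noteq> {}"
        "\<And>i. i \<in> \<sigma> k \<Longrightarrow> \<sigma>(k := {i}) \<in> dowker_product {1..m} I R" for \<sigma>
      using k that by (rule dowker_product_full)
  qed (use k prod_complex_dowker_product in simp_all)
  show "geom_quotient_map {1..m} k ` topspace (realization {1..m} I (dowker_product {1..m} I R))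
      = topspace (realization ({1..m} - {k}) I (dowkerian_quotient {1..m} k (dowker_product {1..m} I R))) \<and>
    homotopy_equivalence_map (realization {1..m} I (dowker_product {1..m} I R))
      (realization ({1..m} - {k}) I (dowkerian_quotient {1..m} k (dowker_product {1..m} I R)))
      (geom_quotient_map {1..m} k)"
    using quotient_image homotopy_equivalence_quotient by blast
qed

end
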